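(* Let $k\geq 1$. (1) ${\sf EA}^{2}+\mathrm{IND}+(\Pi^{1}_{1}(\Sigma^{0}_{k+1})\text{-CA})^{-}\vdash\Sigma^{0}_{k}\text{-IND}$. (2) Let $\varphi(X,y)\in\Pi^{0}_{1}$ be an $X$-positive formula. If $\Pi^{0}_{k}(\Omega)\text{-ID}(\Pi^{0}_{1})\vdash A(R_{\varphi})$, then ${\sf EA}^{2}+\mathrm{IND}+(\Pi^{1}_{1}(\Sigma^{0}_{k+1})\text{-CA})^{-}\vdash A(I_{\varphi})$. (3) For any $X$-positive formula $\varphi(X,y)$, if $\mathrm{ID}_{1}\vdash A(R_{\varphi})$, then ${\sf EA}^{2}+\mathrm{IND}+(\Pi^{1}_{1}\text{-CA})^{-}\vdash A(I_{\varphi})$.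
   Context: First-order setting. $\mathcal{L}$ is the language of first-order arithmetic with relation symbols $=,<$ and function constants for all elementary recursive functions. ${\sf EA}$ is the $\mathcal L$-theory whose axioms are the defining axioms of the function constants, axioms for $=,<$, and the induction schema $\theta(0)\land\forall x(\theta(x)\to\theta(x+1))\to\forall y\,\theta(y)$ for bounded $\mathcal{L}$-formulas $\theta$. An $X$-positive formula $\varphi(X,x)$ is a first-order formula of $\mathcal{L}\cup\{X\}$ ($X$ a unary predicate variable) in which $X$ occurs only positively. The language $\mathcal{L}(\mathrm{ID})$ adds to $\mathcal{L}$ a unary predicate constant $R_\varphi$ for each $X$-positive $\varphi(X,x)$. $\mathrm{ID}_1$ is the extension of first-order (Peano) arithmetic in $\mathcal{L}(\mathrm{ID})$ with the axioms (Ind) $\theta(0)\land\forall x(\theta(x)\to\theta(x+1))\to\forall y\,\theta(y)$, (R1) $\forall x[\varphi(R_\varphi,x)\to R_\varphi(x)]$, (R2) $\forall u[R_\varphi(u)\to\forall x(\varphi(\sigma,x)\to\sigma(x))\to\sigma(u)]$, for all $X$-positive $\varphi$ and all $\mathcal{L}(\mathrm{ID})$-formulas $\theta,\sigma$. The classes $\Pi^0_k(\Omega),\Sigma^0_k(\Omega)$: $\Pi^0_0(\Omega)=\Sigma^0_0(\Omega)$ is the class of formulas built from atomic formulas $t\in R_\varphi$, $t=s$, $t<s$ by propositional connectives $\lnot,\lor,\land$ and bounded quantifiers (the $R_\varphi$ may occur positively and negatively); $\Pi^0_k(\Omega)\cup\Sigma^0_k(\Omega)\subset\Pi^0_{k+1}(\Omega)\cap\Sigma^0_{k+1}(\Omega)$;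 each class is closed under $\lor,\land$ and bounded quantification; negation interchanges $\Pi^0_k(\Omega)$ and $\Sigma^0_k(\Omega)$; for $k\ge1$, $\Pi^0_k(\Omega)$ is closed under $\forall x$ and $\Sigma^0_k(\Omega)$ under $\exists x$. $\Pi^0_k(\Omega)\text{-ID}(\Pi^0_1)$ is the fragment of $\mathrm{ID}_1$ extending ${\sf EA}$ in which only $X$-positive $\varphi\in\Pi^0_1$ are allowed (the predicates are the $R_\varphi$ for these $\varphi$), and the formulas $\theta$ in (Ind) and $\sigma$ in (R2) are restricted to $\Pi^0_k(\Omega)$. Second-order setting. ${\sf EA}^2$ is elementary recursive arithmetic formulated in second-order logic (number variables and set variables), with no comprehension axiom assumed whatsoever. $\mathrm{IND}$ is the sentence $\forall X\forall a[X(0)\land\forall y(X(y)\to X(y+1))\to X(a)]$. For a class $\Lambda$ of arithmetical formulas, $(\Pi^1_1(\Lambda)\text{-CA})^-$ is the schema $\exists Y\forall n[n\in Y\leftrightarrow\forall X\,\lambda(X,n)]$ for $\lambda\in\Lambda$ containing no set parameters (number parameters are allowed). $(\Pi^1_1\text{-CA})^-$ is this schema for all arithmetical $\lambda$ without set parameters. $\Sigma^0_k\text{-IND}$ is the complete induction schema for $\Sigma^0_k$-formulas, in which set parameters and number parameters may occur. For a first-order positive formula $\varphi(X,y)$, $I_\varphi=\bigcap\{X:\varphi(X)\subset X\}$, i.e. $t\in I_\varphi$ abbreviates $\forall X[\forall y(\varphi(X,y)\to y\in X)\to t\in X]$. $A(R_\varphi)$ is a formula in which $R_\varphi$ may occur,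 and $A(I_\varphi)$ is the result of replacing $R_\varphi(t)$ by $t\in I_\varphi$.
   Formalization: In (1), induction instances with at most m set parameters are proved from comprehension with blocks of m universal set quantifiers (m=1 is the literal schema); with a single ∀X the claim fails for two set parameters, e.g. two Cohen generics differing on a cofinal set of type ω. *)

theory Defs
  imports Main
begin

section \<open>Function constants, terms and formulas\<close>

text \<open>
  The function constants are notations for the Kalmar elementary functions: the least class
  containing the listed initial functions and closed under composition, bounded sums and bounded
  products.  \<open>Comp n f gs\<close> is the \<open>n\<close>-ary function \<open>f(g\<^sub>1(x\<^sub>1,\<dots>,x\<^sub>n),g\<^sub>2(x\<^sub>1,\<dots>,x\<^sub>n),\<dots>)\<close>, and \<open>BSum f\<close>,
  \<open>BProd f\<close> map \<open>(y,x\<^sub>1,x\<^sub>2,\<dots>)\<close> to the sum (product) of all \<open>f(i,x\<^sub>1,x\<^sub>2,\<dots>)\<close> with \<open>i < y\<close>.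
\<close>

datatype efun =
    Zero | Succ | Proj nat nat | Plus | Times | Monus
  | Comp nat efun "efun list" | BSum efun | BProd efun

fun arity :: "efun \<Rightarrow> nat" where
  "arity Zero = 0"
| "arity Succ = 1"
| "arity (Proj n i) = n"
| "arity Plus = 2"
| "arity Times = 2"
| "arity Monus = 2"
| "arity (Comp n f gs) = n"
| "arity (BSum f) = arity f"
| "arity (BProd f) = arity f"

fun wf_efun :: "efun \<Rightarrow> bool" where
  "wf_efun (Proj n i) \<longleftrightarrow> i < n"
| "wf_efun (Comp n f gs) \<longleftrightarrow>
     wf_efun f \<and> length gs = arity f \<and> (\<forall>g\<in>set gs. wf_efun g \<and> arity g = n)"
| "wf_efun (BSum f) \<longleftrightarrow> wf_efun f \<and> arity f \<noteq> 0"
| "wf_efun (BProd f) \<longleftrightarrow> wf_efun f \<and> arity f \<noteq> 0"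
| "wf_efun _ \<longleftrightarrow> True"

datatype trm = Var nat | Fn efun "trm list"

fun wf_trm :: "trm \<Rightarrow> bool" where
  "wf_trm (Var i) \<longleftrightarrow> True"
| "wf_trm (Fn f ts) \<longleftrightarrow> wf_efun f \<and> length ts = arity f \<and> (\<forall>t\<in>set ts. wf_trm t)"

abbreviation tzero :: trm where "tzero \<equiv> Fn Zero []"
abbreviation tsucc :: "trm \<Rightarrow> trm" where "tsucc t \<equiv> Fn Succ [t]"
abbreviation tplus :: "trm \<Rightarrow> trm \<Rightarrow> trm" where "tplus s t \<equiv> Fn Plus [s, t]"
abbreviation ttimes :: "trm \<Rightarrow> trm \<Rightarrow> trm" where "ttimes s t \<equiv> Fn Times [s, t]"
abbreviation tmonus :: "trm \<Rightarrow> trm \<Rightarrow> trm" where "tmonus s t \<equiv> Fn Monus [s, t]"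

text \<open>
  One type of formulas serves both settings; the languages are carved out below.  Number variables
  and set variables are de Bruijn indices, counted separately: \<open>Forall\<close>, \<open>Exists\<close> bind number
  variable \<open>0\<close>, and \<open>ForallS\<close>, \<open>ExistsS\<close> bind set variable \<open>0\<close>.  \<open>SVar i t\<close> is \<open>X\<^sub>i(t)\<close>.
  \<open>RPred \<phi> t\<close> is \<open>R\<^sub>\<phi>(t)\<close>, where in \<open>\<phi>(X,x)\<close> the variable \<open>X\<close> is set variable \<open>0\<close> and \<open>x\<close> is number
  variable \<open>0\<close>; here \<open>\<phi>\<close> is part of the name of a constant, so no operation on formulas
  descends into it.
\<close>

datatype fm =
    Eq trm trm | Less trm trm | SVar nat trm | RPred fm trm
  | Neg fm | Conj fm fm | Disj fm fm
  | Forall fm | Exists fm | ForallS fm | ExistsS fm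

abbreviation Imp :: "fm \<Rightarrow> fm \<Rightarrow> fm" where "Imp A B \<equiv> Disj (Neg A) B"
abbreviation Iff :: "fm \<Rightarrow> fm \<Rightarrow> fm" where "Iff A B \<equiv> Conj (Imp A B) (Imp B A)"

primrec wf_fm :: "fm \<Rightarrow> bool" where
  "wf_fm (Eq s t) \<longleftrightarrow> wf_trm s \<and> wf_trm t"
| "wf_fm (Less s t) \<longleftrightarrow> wf_trm s \<and> wf_trm t"
| "wf_fm (SVar i t) \<longleftrightarrow> wf_trm t"
| "wf_fm (RPred \<phi> t) \<longleftrightarrow> wf_trm t"
| "wf_fm (Neg A) \<longleftrightarrow> wf_fm A"
| "wf_fm (Conj A B) \<longleftrightarrow> wf_fm A \<and> wf_fm B"
| "wf_fm (Disj A B) \<longleftrightarrow> wf_fm A \<and> wf_fm B"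
| "wf_fm (Forall A) \<longleftrightarrow> wf_fm A"
| "wf_fm (Exists A) \<longleftrightarrow> wf_fm A"
| "wf_fm (ForallS A) \<longleftrightarrow> wf_fm A"
| "wf_fm (ExistsS A) \<longleftrightarrow> wf_fm A"

text \<open>Absence of set quantifiers; set variables may occur.\<close>

primrec arithmetical :: "fm \<Rightarrow> bool" where
  "arithmetical (Eq s t) \<longleftrightarrow> True"
| "arithmetical (Less s t) \<longleftrightarrow> True"
| "arithmetical (SVar i t) \<longleftrightarrow> True"
| "arithmetical (RPred \<phi> t) \<longleftrightarrow> True"
| "arithmetical (Neg A) \<longleftrightarrow> arithmetical A"
| "arithmetical (Conj A B) \<longleftrightarrow> arithmetical A \<and> arithmetical B"
| "arithmetical (Disj A B) \<longleftrightarrow> arithmetical A \<and> arithmetical B"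
| "arithmetical (Forall A) \<longleftrightarrow> arithmetical A"
| "arithmetical (Exists A) \<longleftrightarrow> arithmetical A"
| "arithmetical (ForallS A) \<longleftrightarrow> False"
| "arithmetical (ExistsS A) \<longleftrightarrow> False"

text \<open>The \<open>\<phi>\<close> such that the constant \<open>R\<^sub>\<phi>\<close> occurs.\<close>

primrec preds :: "fm \<Rightarrow> fm set" where
  "preds (Eq s t) = {}"
| "preds (Less s t) = {}"
| "preds (SVar i t) = {}"
| "preds (RPred \<phi> t) = {\<phi>}"
| "preds (Neg A) = preds A"
| "preds (Conj A B) = preds A \<union> preds B"
| "preds (Disj A B) = preds A \<union> preds B"
| "preds (Forall A) = preds A"
| "preds (Exists A) = preds A"
| "preds (ForallS A) = preds A"
| "preds (ExistsS A) = preds A"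

fun fv_trm :: "trm \<Rightarrow> nat set" where
  "fv_trm (Var i) = {i}"
| "fv_trm (Fn f ts) = (\<Union>t\<in>set ts. fv_trm t)"

primrec fv :: "fm \<Rightarrow> nat set" where
  "fv (Eq s t) = fv_trm s \<union> fv_trm t"
| "fv (Less s t) = fv_trm s \<union> fv_trm t"
| "fv (SVar i t) = fv_trm t"
| "fv (RPred \<phi> t) = fv_trm t"
| "fv (Neg A) = fv A"
| "fv (Conj A B) = fv A \<union> fv B"
| "fv (Disj A B) = fv A \<union> fv B"
| "fv (Forall A) = {i. Suc i \<in> fv A}"
| "fv (Exists A) = {i. Suc i \<in> fv A}"
| "fv (ForallS A) = fv A"
| "fv (ExistsS A) = fv A"

primrec fsv :: "fm \<Rightarrow> nat set" where
  "fsv (Eq s t) = {}"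
| "fsv (Less s t) = {}"
| "fsv (SVar i t) = {i}"
| "fsv (RPred \<phi> t) = {}"
| "fsv (Neg A) = fsv A"
| "fsv (Conj A B) = fsv A \<union> fsv B"
| "fsv (Disj A B) = fsv A \<union> fsv B"
| "fsv (Forall A) = fsv A"
| "fsv (Exists A) = fsv A"
| "fsv (ForallS A) = {i. Suc i \<in> fsv A}"
| "fsv (ExistsS A) = {i. Suc i \<in> fsv A}"

text \<open>
  \<open>occurs_only True i A\<close>: set variable \<open>i\<close> occurs only positively in \<open>A\<close>;
  \<open>occurs_only False i A\<close>: only negatively.
\<close>

primrec occurs_only :: "bool \<Rightarrow> nat \<Rightarrow> fm \<Rightarrow> bool" where
  "occurs_only p i (Eq s t) \<longleftrightarrow> True"
| "occurs_only p i (Less s t) \<longleftrightarrow> True"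
| "occurs_only p i (SVar j t) \<longleftrightarrow> (j = i \<longrightarrow> p)"
| "occurs_only p i (RPred \<phi> t) \<longleftrightarrow> True"
| "occurs_only p i (Neg A) \<longleftrightarrow> occurs_only (\<not> p) i A"
| "occurs_only p i (Conj A B) \<longleftrightarrow> occurs_only p i A \<and> occurs_only p i B"
| "occurs_only p i (Disj A B) \<longleftrightarrow> occurs_only p i A \<and> occurs_only p i B"
| "occurs_only p i (Forall A) \<longleftrightarrow> occurs_only p i A"
| "occurs_only p i (Exists A) \<longleftrightarrow> occurs_only p i A"
| "occurs_only p i (ForallS A) \<longleftrightarrow> occurs_only p (Suc i) A"
| "occurs_only p i (ExistsS A) \<longleftrightarrow> occurs_only p (Suc i) A"

section \<open>Substitution\<close>

fun sub_trm :: "(nat \<Rightarrow> trm) \<Rightarrow> trm \<Rightarrow> trm" where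
  "sub_trm s (Var i) = s i"
| "sub_trm s (Fn f ts) = Fn f (map (sub_trm s) ts)"

definition lift_trm :: "trm \<Rightarrow> trm" where
  "lift_trm = sub_trm (\<lambda>i. Var (Suc i))"

text \<open>Simultaneous substitution of terms for the free number variables.\<close>

primrec sub :: "(nat \<Rightarrow> trm) \<Rightarrow> fm \<Rightarrow> fm" where
  "sub s (Eq t u) = Eq (sub_trm s t) (sub_trm s u)"
| "sub s (Less t u) = Less (sub_trm s t) (sub_trm s u)"
| "sub s (SVar i t) = SVar i (sub_trm s t)"
| "sub s (RPred \<phi> t) = RPred \<phi> (sub_trm s t)"
| "sub s (Neg A) = Neg (sub s A)"
| "sub s (Conj A B) = Conj (sub s A) (sub s B)"
| "sub s (Disj A B) = Disj (sub s A) (sub s B)"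
| "sub s (Forall A) = Forall (sub (case_nat (Var 0) (\<lambda>i. lift_trm (s i))) A)"
| "sub s (Exists A) = Exists (sub (case_nat (Var 0) (\<lambda>i. lift_trm (s i))) A)"
| "sub s (ForallS A) = ForallS (sub s A)"
| "sub s (ExistsS A) = ExistsS (sub s A)"

text \<open>Simultaneous renaming of the free set variables.\<close>

primrec renS :: "(nat \<Rightarrow> nat) \<Rightarrow> fm \<Rightarrow> fm" where
  "renS r (Eq t u) = Eq t u"
| "renS r (Less t u) = Less t u"
| "renS r (SVar i t) = SVar (r i) t"
| "renS r (RPred \<phi> t) = RPred \<phi> t"
| "renS r (Neg A) = Neg (renS r A)"
| "renS r (Conj A B) = Conj (renS r A) (renS r B)"
| "renS r (Disj A B) = Disj (renS r A) (renS r B)"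
| "renS r (Forall A) = Forall (renS r A)"
| "renS r (Exists A) = Exists (renS r A)"
| "renS r (ForallS A) = ForallS (renS (case_nat 0 (\<lambda>i. Suc (r i))) A)"
| "renS r (ExistsS A) = ExistsS (renS (case_nat 0 (\<lambda>i. Suc (r i))) A)"

definition inst :: "fm \<Rightarrow> trm \<Rightarrow> fm" where
  "inst A t = sub (case_nat t Var) A"

definition lift :: "fm \<Rightarrow> fm" where
  "lift = sub (\<lambda>i. Var (Suc i))"

text \<open>
  For a formula read as a predicate of number variable \<open>0\<close>: lift the parameters only.
\<close>

definition lift1 :: "fm \<Rightarrow> fm" where
  "lift1 = sub (case_nat (Var 0) (\<lambda>i. Var (Suc (Suc i))))"

definition instS :: "fm \<Rightarrow> nat \<Rightarrow> fm" where
  "instS A j = renS (case_nat j (\<lambda>i. i)) A"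

definition liftS :: "fm \<Rightarrow> fm" where
  "liftS = renS Suc"

text \<open>
  \<open>repl i \<sigma> A\<close> replaces every \<open>X\<^sub>i(t)\<close> in \<open>A\<close> by \<open>\<sigma>(t)\<close>, where \<open>\<sigma>\<close> is read as a predicate of number
  variable \<open>0\<close> whose variable \<open>Suc j\<close> denotes the variable \<open>j\<close> of the context of \<open>A\<close>.
\<close>

primrec repl :: "nat \<Rightarrow> fm \<Rightarrow> fm \<Rightarrow> fm" where
  "repl i \<sigma> (Eq s t) = Eq s t"
| "repl i \<sigma> (Less s t) = Less s t"
| "repl i \<sigma> (SVar j t) = (if j = i then inst \<sigma> t else SVar j t)"
| "repl i \<sigma> (RPred \<phi> t) = RPred \<phi> t"
| "repl i \<sigma> (Neg A) = Neg (repl i \<sigma> A)"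
| "repl i \<sigma> (Conj A B) = Conj (repl i \<sigma> A) (repl i \<sigma> B)"
| "repl i \<sigma> (Disj A B) = Disj (repl i \<sigma> A) (repl i \<sigma> B)"
| "repl i \<sigma> (Forall A) = Forall (repl i (lift1 \<sigma>) A)"
| "repl i \<sigma> (Exists A) = Exists (repl i (lift1 \<sigma>) A)"
| "repl i \<sigma> (ForallS A) = ForallS (repl (Suc i) (liftS \<sigma>) A)"
| "repl i \<sigma> (ExistsS A) = ExistsS (repl (Suc i) (liftS \<sigma>) A)"

text \<open>\<open>t \<in> I\<^sub>\<phi>\<close>, i.e. \<open>\<forall>X[\<forall>y(\<phi>(X,y) \<rightarrow> y \<in> X) \<rightarrow> t \<in> X]\<close>, for \<open>\<phi>\<close> without further free variables.\<close>

definition inI :: "fm \<Rightarrow> trm \<Rightarrow> fm" where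
  "inI \<phi> t = ForallS (Imp (Forall (Imp \<phi> (SVar 0 (Var 0)))) (SVar 0 t))"

text \<open>\<open>replR \<phi> A\<close> is \<open>A(I\<^sub>\<phi>)\<close> for \<open>A = A(R\<^sub>\<phi>)\<close>.\<close>

primrec replR :: "fm \<Rightarrow> fm \<Rightarrow> fm" where
  "replR \<phi> (Eq s t) = Eq s t"
| "replR \<phi> (Less s t) = Less s t"
| "replR \<phi> (SVar i t) = SVar i t"
| "replR \<phi> (RPred \<psi> t) = (if \<psi> = \<phi> then inI \<phi> t else RPred \<psi> t)"
| "replR \<phi> (Neg A) = Neg (replR \<phi> A)"
| "replR \<phi> (Conj A B) = Conj (replR \<phi> A) (replR \<phi> B)"
| "replR \<phi> (Disj A B) = Disj (replR \<phi> A) (replR \<phi> B)"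
| "replR \<phi> (Forall A) = Forall (replR \<phi> A)"
| "replR \<phi> (Exists A) = Exists (replR \<phi> A)"
| "replR \<phi> (ForallS A) = ForallS (replR \<phi> A)"
| "replR \<phi> (ExistsS A) = ExistsS (replR \<phi> A)"

section \<open>Languages and formula classes\<close>

text \<open>
  The first-order language with the constants \<open>R\<^sub>\<phi>\<close> for \<open>\<phi> \<in> C\<close>; \<open>lang1 {}\<close> is the language of
  first-order arithmetic.
\<close>

definition lang1 :: "fm set \<Rightarrow> fm set" where
  "lang1 C = {A. wf_fm A \<and> arithmetical A \<and> fsv A = {} \<and> preds A \<subseteq> C}"

definition lang2 :: "fm set" where
  "lang2 = {A. wf_fm A \<and> preds A = {}}"

text \<open>The \<open>X\<close>-positive formulas \<open>\<phi>(X,x)\<close>.\<close>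

definition Xpos :: "fm set" where
  "Xpos = {\<phi>. \<phi> \<in> lang2 \<and> arithmetical \<phi> \<and> fsv \<phi> \<subseteq> {0} \<and> fv \<phi> \<subseteq> {0} \<and> occurs_only True 0 \<phi>}"

definition ForallB :: "trm \<Rightarrow> fm \<Rightarrow> fm" where
  "ForallB t A = Forall (Imp (Less (Var 0) (lift_trm t)) A)"

definition ExistsB :: "trm \<Rightarrow> fm \<Rightarrow> fm" where
  "ExistsB t A = Exists (Conj (Less (Var 0) (lift_trm t)) A)"

text \<open>
  \<open>hier True k\<close> and \<open>hier False k\<close> are \<open>\<Pi>\<^sup>0\<^sub>k\<close> and \<open>\<Sigma>\<^sup>0\<^sub>k\<close>: on \<open>lang1 C\<close> they are
  \<open>\<Pi>\<^sup>0\<^sub>k(\<Omega>)\<close> and \<open>\<Sigma>\<^sup>0\<^sub>k(\<Omega>)\<close>, on \<open>lang2\<close> the usual classes of arithmetical formulas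
  with set variables.
\<close>

inductive hier :: "bool \<Rightarrow> nat \<Rightarrow> fm \<Rightarrow> bool" where
  "hier p 0 (Eq s t)"
| "hier p 0 (Less s t)"
| "hier p 0 (SVar i t)"
| "hier p 0 (RPred \<phi> t)"
| "hier p k A \<Longrightarrow> hier q (Suc k) A"
| "hier (\<not> p) k A \<Longrightarrow> hier p k (Neg A)"
| "hier p k A \<Longrightarrow> hier p k B \<Longrightarrow> hier p k (Conj A B)"
| "hier p k A \<Longrightarrow> hier p k B \<Longrightarrow> hier p k (Disj A B)"
| "hier p k A \<Longrightarrow> hier p k (ForallB t A)"
| "hier p k A \<Longrightarrow> hier p k (ExistsB t A)"
| "hier True (Suc k) A \<Longrightarrow> hier True (Suc k) (Forall A)"
| "hier False (Suc k) A \<Longrightarrow> hier False (Suc k) (Exists A)"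

abbreviation Pi0 :: "nat \<Rightarrow> fm \<Rightarrow> bool" where "Pi0 \<equiv> hier True"
abbreviation Sigma0 :: "nat \<Rightarrow> fm \<Rightarrow> bool" where "Sigma0 \<equiv> hier False"

section \<open>Provability\<close>

text \<open>
  Truth of \<open>A\<close> under a propositional valuation \<open>v\<close>, formulas that are atomic or start with a
  quantifier being the propositional letters.
\<close>

fun pval :: "(fm \<Rightarrow> bool) \<Rightarrow> fm \<Rightarrow> bool" where
  "pval v (Neg A) \<longleftrightarrow> \<not> pval v A"
| "pval v (Conj A B) \<longleftrightarrow> pval v A \<and> pval v B"
| "pval v (Disj A B) \<longleftrightarrow> pval v A \<or> pval v B"
| "pval v A \<longleftrightarrow> v A"

text \<open>
  Derivability from the universal closures of the formulas in \<open>T\<close> in classical two-sorted logic with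
  equality between numbers, all formulas of a derivation belonging to the language \<open>L\<close>.  Set
  quantifiers are instantiated by set variables only, so that no comprehension is built into
  the logic.  For \<open>L = lang1 C\<close> this is first-order logic, since then no formula contains
  set variables or set quantifiers.
\<close>

inductive provable :: "fm set \<Rightarrow> fm set \<Rightarrow> fm \<Rightarrow> bool" for L T where
  Ax: "A \<in> T \<Longrightarrow> A \<in> L \<Longrightarrow> provable L T A"
| Taut: "(\<And>v. pval v A) \<Longrightarrow> A \<in> L \<Longrightarrow> provable L T A"
| MP: "provable L T A \<Longrightarrow> provable L T (Imp A B) \<Longrightarrow> B \<in> L \<Longrightarrow> provable L T B"
| EqRefl: "Eq t t \<in> L \<Longrightarrow> provable L T (Eq t t)"
| EqSubst: "Imp (Eq s t) (Imp (inst A s) (inst A t)) \<in> L \<Longrightarrow>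
    provable L T (Imp (Eq s t) (Imp (inst A s) (inst A t)))"
| AllE: "Imp (Forall A) (inst A t) \<in> L \<Longrightarrow> provable L T (Imp (Forall A) (inst A t))"
| ExI: "Imp (inst A t) (Exists A) \<in> L \<Longrightarrow> provable L T (Imp (inst A t) (Exists A))"
| AllI: "provable L T (Imp (lift B) A) \<Longrightarrow> Imp B (Forall A) \<in> L \<Longrightarrow>
    provable L T (Imp B (Forall A))"
| ExE: "provable L T (Imp A (lift B)) \<Longrightarrow> Imp (Exists A) B \<in> L \<Longrightarrow>
    provable L T (Imp (Exists A) B)"
| AllSE: "Imp (ForallS A) (instS A j) \<in> L \<Longrightarrow> provable L T (Imp (ForallS A) (instS A j))"
| ExSI: "Imp (instS A j) (ExistsS A) \<in> L \<Longrightarrow> provable L T (Imp (instS A j) (ExistsS A))"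
| AllSI: "provable L T (Imp (liftS B) A) \<Longrightarrow> Imp B (ForallS A) \<in> L \<Longrightarrow>
    provable L T (Imp B (ForallS A))"
| ExSE: "provable L T (Imp A (liftS B)) \<Longrightarrow> Imp (ExistsS A) B \<in> L \<Longrightarrow>
    provable L T (Imp (ExistsS A) B)"

section \<open>The theories\<close>

text \<open>
  Complete induction for \<open>\<theta>(x)\<close>, where \<open>x\<close> is number variable \<open>0\<close>; the successor of \<open>x\<close> stands for \<open>x+1\<close>.
\<close>

definition induction_ax :: "fm \<Rightarrow> fm" where
  "induction_ax \<theta> =
     Imp (Conj (inst \<theta> tzero)
               (Forall (Imp \<theta> (sub (case_nat (tsucc (Var 0)) (\<lambda>i. Var (Suc i))) \<theta>))))
         (Forall \<theta>)"

inductive_set EA :: "fm set" where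
  Succ_neq_Zero: "Neg (Eq (tsucc (Var 0)) tzero) \<in> EA"
| Succ_inject: "Imp (Eq (tsucc (Var 0)) (tsucc (Var 1))) (Eq (Var 0) (Var 1)) \<in> EA"
| Proj: "i < n \<Longrightarrow> Eq (Fn (Proj n i) (map Var [0..<n])) (Var i) \<in> EA"
| Plus_Zero: "Eq (tplus (Var 0) tzero) (Var 0) \<in> EA"
| Plus_Succ: "Eq (tplus (Var 0) (tsucc (Var 1))) (tsucc (tplus (Var 0) (Var 1))) \<in> EA"
| Times_Zero: "Eq (ttimes (Var 0) tzero) tzero \<in> EA"
| Times_Succ: "Eq (ttimes (Var 0) (tsucc (Var 1))) (tplus (ttimes (Var 0) (Var 1)) (Var 0)) \<in> EA"
| Monus_Zero: "Eq (tmonus (Var 0) tzero) (Var 0) \<in> EA"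
| Zero_Monus: "Eq (tmonus tzero (tsucc (Var 0))) tzero \<in> EA"
| Succ_Monus: "Eq (tmonus (tsucc (Var 0)) (tsucc (Var 1))) (tmonus (Var 0) (Var 1)) \<in> EA"
| Comp: "wf_efun (Comp n f gs) \<Longrightarrow> xs = map Var [0..<n] \<Longrightarrow>
    Eq (Fn (Comp n f gs) xs) (Fn f (map (\<lambda>g. Fn g xs) gs)) \<in> EA"
| BSum_Zero: "wf_efun (BSum f) \<Longrightarrow> xs = map Var [1..<arity f] \<Longrightarrow>
    Eq (Fn (BSum f) (tzero # xs)) tzero \<in> EA"
| BSum_Succ: "wf_efun (BSum f) \<Longrightarrow> xs = map Var [1..<arity f] \<Longrightarrow>
    Eq (Fn (BSum f) (tsucc (Var 0) # xs)) (tplus (Fn (BSum f) (Var 0 # xs)) (Fn f (Var 0 # xs))) \<in> EA"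
| BProd_Zero: "wf_efun (BProd f) \<Longrightarrow> xs = map Var [1..<arity f] \<Longrightarrow>
    Eq (Fn (BProd f) (tzero # xs)) (tsucc tzero) \<in> EA"
| BProd_Succ: "wf_efun (BProd f) \<Longrightarrow> xs = map Var [1..<arity f] \<Longrightarrow>
    Eq (Fn (BProd f) (tsucc (Var 0) # xs)) (ttimes (Fn (BProd f) (Var 0 # xs)) (Fn f (Var 0 # xs))) \<in> EA"
| Not_Less_Zero: "Neg (Less (Var 0) tzero) \<in> EA"
| Less_Succ: "Iff (Less (Var 0) (tsucc (Var 1)))
                  (Disj (Less (Var 0) (Var 1)) (Eq (Var 0) (Var 1))) \<in> EA"
| Bounded_Ind: "\<theta> \<in> lang1 {} \<Longrightarrow> Pi0 0 \<theta> \<Longrightarrow> induction_ax \<theta> \<in> EA"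

text \<open>\<open>\<forall>x[\<phi>(R\<^sub>\<phi>,x) \<rightarrow> R\<^sub>\<phi>(x)]\<close>\<close>

definition R1_ax :: "fm \<Rightarrow> fm" where
  "R1_ax \<phi> = Forall (Imp (repl 0 (RPred \<phi> (Var 0)) \<phi>) (RPred \<phi> (Var 0)))"

text \<open>
  \<open>\<forall>u[R\<^sub>\<phi>(u) \<rightarrow> \<forall>x(\<phi>(\<sigma>,x) \<rightarrow> \<sigma>(x)) \<rightarrow> \<sigma>(u)]\<close>.  The distinguished variable of \<open>\<sigma>\<close> is number variable \<open>0\<close>.
  The parameters of \<open>\<sigma>(x)\<close> have to bypass \<open>u\<close>, those of \<open>\<sigma>\<close> within \<open>\<phi>(\<sigma>,x)\<close> both \<open>u\<close> and \<open>x\<close>.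
\<close>

definition R2_ax :: "fm \<Rightarrow> fm \<Rightarrow> fm" where
  "R2_ax \<phi> \<sigma> =
     Forall (Imp (RPred \<phi> (Var 0))
                 (Imp (Forall (Imp (repl 0 (lift1 (lift1 \<sigma>)) \<phi>) (lift1 \<sigma>)))
                      \<sigma>))"

text \<open>
  The theory of the \<open>R\<^sub>\<phi>\<close>, \<open>\<phi> \<in> C\<close>, in the language \<open>lang1 C\<close>, with the formulas in the
  schemata (Ind) and (R2) restricted to the class \<open>K\<close>.
\<close>

definition ID :: "fm set \<Rightarrow> (fm \<Rightarrow> bool) \<Rightarrow> fm set" where
  "ID C K =
     EA \<union> {induction_ax \<theta> | \<theta>. \<theta> \<in> lang1 C \<and> K \<theta>}
        \<union> {R1_ax \<phi> | \<phi>. \<phi> \<in> C}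
        \<union> {R2_ax \<phi> \<sigma> | \<phi> \<sigma>. \<phi> \<in> C \<and> \<sigma> \<in> lang1 C \<and> K \<sigma>}"

definition ID1_proves :: "fm \<Rightarrow> bool" where
  "ID1_proves = provable (lang1 Xpos) (ID Xpos (\<lambda>_. True))"

definition Xpos_Pi1 :: "fm set" where
  "Xpos_Pi1 = {\<phi> \<in> Xpos. Pi0 1 \<phi>}"

definition PiID_Pi1_proves :: "nat \<Rightarrow> fm \<Rightarrow> bool" where
  "PiID_Pi1_proves k = provable (lang1 Xpos_Pi1) (ID Xpos_Pi1 (Pi0 k))"

definition IND :: fm where
  "IND = ForallS (Forall
     (Imp (Conj (SVar 0 tzero) (Forall (Imp (SVar 0 (Var 0)) (SVar 0 (tsucc (Var 0))))))
          (SVar 0 (Var 0))))"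

text \<open>
  The schema \<open>\<exists>Y\<forall>n[n \<in> Y \<leftrightarrow> \<forall>X\<^sub>1\<dots>\<forall>X\<^sub>m \<lambda>]\<close> for arithmetical \<open>\<lambda> \<in> \<Lambda>\<close> whose set variables are among
  \<open>X\<^sub>1,\<dots>,X\<^sub>m\<close>; the variable \<open>n\<close> is number variable \<open>0\<close>, and the other number variables are parameters.
  The case \<open>m = 1\<close> is the schema with a single set quantifier.  The length of the block matters:
  without comprehension for formulas with set parameters, finitely many sets cannot in general
  be coded into one set.
\<close>

definition Pi11_CA :: "nat \<Rightarrow> (fm \<Rightarrow> bool) \<Rightarrow> fm set" where
  "Pi11_CA m \<Lambda> =
     {ExistsS (Forall (Iff (SVar 0 (Var 0)) ((ForallS ^^ m) A))) | A.
        A \<in> lang2 \<and> arithmetical A \<and> fsv A \<subseteq> {..<m} \<and> \<Lambda> A}"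

text \<open>
  Provability in \<open>EA\<^sup>2 + IND\<close> plus comprehension.  \<open>EA\<^sup>2\<close> has the axioms of \<open>EA\<close>, its induction
  schema being that for bounded formulas of first-order arithmetic: if set variables were admitted
  there, \<open>IND\<close> would be redundant.
\<close>

definition EA2_CA_proves :: "nat \<Rightarrow> (fm \<Rightarrow> bool) \<Rightarrow> fm \<Rightarrow> bool" where
  "EA2_CA_proves m \<Lambda> = provable lang2 (EA \<union> {IND} \<union> Pi11_CA m \<Lambda>)"

text \<open>The instances of \<open>\<Sigma>\<^sup>0\<^sub>k-IND\<close> with at most \<open>m\<close> set parameters.\<close>

definition Sigma_IND :: "nat \<Rightarrow> nat \<Rightarrow> fm set" where
  "Sigma_IND m k = {induction_ax \<theta> | \<theta>. \<theta> \<in> lang2 \<and> Sigma0 k \<theta> \<and> card (fsv \<theta>) \<le> m}"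

end

theory Submission
  imports Defs "HOL-Library.Countable_Set"
begin

text \<open>
  All three parts are proved semantically.  The two-sorted calculus is complete for Henkin models,
  in which set quantifiers range over a given collection of sets (\<open>completeness\<close>), so it suffices to
  show that the conclusions hold in every Henkin model \<open>M\<close> of \<open>EA\<^sup>2 + IND\<close> with parameter-free
  comprehension.  In the other direction, a derivation in a theory of fixed points is used only
  through \<open>soundness\<close>, for the expansion of \<open>M\<close> in which \<open>R\<^sub>\<psi>\<close> denotes
  \<open>I\<^sub>\<psi> = \<Inter>{X. \<psi>(X) \<subseteq> X}\<close>, the intersection being taken over the sets of \<open>M\<close>.

  The obstacle is that comprehension has no set parameters.  It is overcome by quantifying the
  parameters away.  For induction on \<open>\<theta>(X,a)\<close> one takes
  \<open>W = {a. \<forall>X (\<theta>(X,0) \<and> \<forall>x(\<theta>(X,x) \<rightarrow> \<theta>(X,x+1)) \<rightarrow> \<theta>(X,a))}\<close>.  This set contains \<open>0\<close> and is closed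
  under successor whatever \<open>\<theta>\<close> is, so \<open>IND\<close> applies to it, and the quantifier may then be instantiated
  (\<open>induction_ax_sat\<close>).  If \<open>\<theta>\<close> is \<open>\<Sigma>\<^sup>0\<^sub>k\<close> or \<open>\<Pi>\<^sup>0\<^sub>k\<close>, the matrix is \<open>\<Sigma>\<^sup>0\<^sub>k\<^sub>+\<^sub>1\<close>.  The same device gives
  (R2): the set \<open>W = {u. \<forall>X (\<forall>x(\<phi>(\<sigma>(X),x) \<rightarrow> \<sigma>(X,x)) \<rightarrow> \<sigma>(X,u))}\<close> satisfies \<open>\<phi>(W) \<subseteq> W\<close> because \<open>\<phi>\<close> is
  positive, hence it contains \<open>I\<^sub>\<phi>\<close> (\<open>valid_R2\<close>).  Substituting a \<open>\<Pi>\<^sup>0\<^sub>k\<close> formula into a positive \<open>\<Pi>\<^sup>0\<^sub>1\<close>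
  formula yields a \<open>\<Pi>\<^sup>0\<^sub>k\<close> formula (\<open>hier_repl\<close>), so again the matrix is \<open>\<Sigma>\<^sup>0\<^sub>k\<^sub>+\<^sub>1\<close>.

  A formula \<open>\<sigma>\<close> of the theory of fixed points may contain several \<open>R\<^sub>\<psi>\<close>, whereas only one set variable
  \<open>X\<close> is available.  Therefore the \<open>I\<^sub>\<psi>\<close> for finitely many \<open>\<psi>\<close> are coded into one set
  \<open>Y = {\<langle>\<psi>,d\<rangle>. d \<in> I\<^sub>\<psi>}\<close>, which is defined by
  \<open>\<forall>X \<Or>\<^sub>\<psi> \<exists>d (z = \<langle>\<psi>,d\<rangle> \<and> (\<psi>(X) \<subseteq> X \<rightarrow> d \<in> X))\<close>, with a single set quantifier over a \<open>\<Sigma>\<^sup>0\<^sub>2\<close> matrix if the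
  \<open>\<psi>\<close> are \<open>\<Pi>\<^sup>0\<^sub>1\<close> (\<open>fixpoints_coded\<close>).  In \<open>\<sigma>\<close> one replaces \<open>R\<^sub>\<psi>(t)\<close> by \<open>X(\<langle>\<psi>,t\<rangle>)\<close> and finally instantiates
  \<open>X\<close> by \<open>Y\<close>.
\<close>

section \<open>Substitution\<close>

text \<open>
  Substitutions and renamings as they act below a quantifier.
\<close>

definition up :: "(nat \<Rightarrow> trm) \<Rightarrow> nat \<Rightarrow> trm" where
  "up s = case_nat (Var 0) (\<lambda>i. lift_trm (s i))"

definition upS :: "(nat \<Rightarrow> nat) \<Rightarrow> nat \<Rightarrow> nat" where
  "upS r = case_nat 0 (\<lambda>i. Suc (r i))"

lemma sub_quantifier [simp]:
  "sub s (Forall A) = Forall (sub (up s) A)" "sub s (Exists A) = Exists (sub (up s) A)"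
  by (simp_all add: up_def)

lemma renS_quantifier [simp]:
  "renS r (ForallS A) = ForallS (renS (upS r) A)" "renS r (ExistsS A) = ExistsS (renS (upS r) A)"
  by (simp_all add: upS_def)

declare sub.simps(8,9) [simp del] renS.simps(10,11) [simp del]

lemma sub_trm_comp: "sub_trm s (sub_trm r t) = sub_trm (\<lambda>i. sub_trm s (r i)) t"
  by (induction t) auto

lemma sub_trm_id [simp]: "sub_trm Var t = t"
  by (induction t) (auto simp: map_idI)

lemma sub_trm_cong: "(\<And>i. i \<in> fv_trm t \<Longrightarrow> s i = s' i) \<Longrightarrow> sub_trm s t = sub_trm s' t"
  by (induction t) auto

lemma sub_trm_lift: "sub_trm (case_nat u s) (lift_trm t) = sub_trm s t"
  by (simp add: lift_trm_def sub_trm_comp)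

lemma lift_sub_trm: "sub_trm (up s) (lift_trm t) = lift_trm (sub_trm s t)"
  by (simp add: lift_trm_def sub_trm_comp up_def)

lemma up_comp: "(\<lambda>i. sub_trm (up s) (up r i)) = up (\<lambda>i. sub_trm s (r i))"
proof
  show "sub_trm (up s) (up r i) = up (\<lambda>i. sub_trm s (r i)) i" for i
    by (cases i) (auto simp: up_def lift_sub_trm[unfolded up_def])
qed

lemma up_Var [simp]: "up Var = Var"
  by (auto simp: up_def lift_trm_def split: nat.splits)

lemma sub_cong: "(\<And>i. i \<in> fv A \<Longrightarrow> s i = s' i) \<Longrightarrow> sub s A = sub s' A"
proof (induction A arbitrary: s s')
  case (Neg A)
  have "sub s A = sub s' A" using Neg.prems by (intro Neg.IH) auto
  then show ?case by simp
next
  case (Conj A B)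
  have "sub s A = sub s' A" "sub s B = sub s' B"
    using Conj.prems by (intro Conj.IH; auto)+
  then show ?case by simp
next
  case (Disj A B)
  have "sub s A = sub s' A" "sub s B = sub s' B"
    using Disj.prems by (intro Disj.IH; auto)+
  then show ?case by simp
next
  case (Forall A)
  have "sub (up s) A = sub (up s') A"
    using Forall.prems by (intro Forall.IH) (auto simp: up_def split: nat.splits)
  then show ?case by simp
next
  case (Exists A)
  have "sub (up s) A = sub (up s') A"
    using Exists.prems by (intro Exists.IH) (auto simp: up_def split: nat.splits)
  then show ?case by simp
next
  case (ForallS A)
  have "sub s A = sub s' A" using ForallS.prems by (intro ForallS.IH) auto
  then show ?case by simp
next
  case (ExistsS A)
  have "sub s A = sub s' A" using ExistsS.prems by (intro ExistsS.IH) auto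
  then show ?case by simp
qed (simp; blast intro: sub_trm_cong)+

lemma sub_id [simp]: "sub Var A = A"
  by (induction A) auto

lemma sub_comp: "sub s (sub r A) = sub (\<lambda>i. sub_trm s (r i)) A"
  by (induction A arbitrary: s r) (auto simp: sub_trm_comp up_comp)

lemma upS_comp: "(\<lambda>i. upS r (upS q i)) = upS (\<lambda>i. r (q i))"
  by (auto simp: upS_def split: nat.splits)

lemma upS_id [simp]: "upS (\<lambda>i. i) = (\<lambda>i. i)"
  by (auto simp: upS_def split: nat.splits)

lemma renS_cong: "(\<And>i. i \<in> fsv A \<Longrightarrow> r i = r' i) \<Longrightarrow> renS r A = renS r' A"
proof (induction A arbitrary: r r')
  case (Neg A)
  have "renS r A = renS r' A" using Neg.prems by (intro Neg.IH) auto
  then show ?case by simp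
next
  case (Conj A B)
  have "renS r A = renS r' A" "renS r B = renS r' B"
    using Conj.prems by (intro Conj.IH; auto)+
  then show ?case by simp
next
  case (Disj A B)
  have "renS r A = renS r' A" "renS r B = renS r' B"
    using Disj.prems by (intro Disj.IH; auto)+
  then show ?case by simp
next
  case (Forall A)
  have "renS r A = renS r' A" using Forall.prems by (intro Forall.IH) auto
  then show ?case by simp
next
  case (Exists A)
  have "renS r A = renS r' A" using Exists.prems by (intro Exists.IH) auto
  then show ?case by simp
next
  case (ForallS A)
  have "renS (upS r) A = renS (upS r') A"
    using ForallS.prems by (intro ForallS.IH) (auto simp: upS_def split: nat.splits)
  then show ?case by simp
next
  case (ExistsS A)
  have "renS (upS r) A = renS (upS r') A"
    using ExistsS.prems by (intro ExistsS.IH) (auto simp: upS_def split: nat.splits)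
  then show ?case by simp
qed auto

lemma renS_id [simp]: "renS (\<lambda>i. i) A = A"
  by (induction A) auto

lemma renS_comp: "renS r (renS q A) = renS (\<lambda>i. r (q i)) A"
  by (induction A arbitrary: r q) (auto simp: upS_comp)

lemma renS_sub: "renS r (sub s A) = sub s (renS r A)"
  by (induction A arbitrary: r s) auto

lemma inst_sub_up: "inst (sub (up s) A) t = sub (case_nat t s) A"
  unfolding inst_def sub_comp
  by (rule sub_cong) (auto simp: up_def sub_trm_lift split: nat.splits)

lemma instS_renS_upS: "instS (renS (upS r) A) j = renS (case_nat j r) A"
  unfolding instS_def renS_comp
  by (rule renS_cong) (auto simp: upS_def split: nat.splits)

lemma preds_sub [simp]: "preds (sub s A) = preds A"
  by (induction A arbitrary: s) auto

lemma preds_renS [simp]: "preds (renS r A) = preds A"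
  by (induction A arbitrary: r) auto

lemma fsv_sub [simp]: "fsv (sub s A) = fsv A"
  by (induction A arbitrary: s) auto

lemma arithmetical_sub [simp]: "arithmetical (sub s A) = arithmetical A"
  by (induction A arbitrary: s) auto

lemma arithmetical_renS [simp]: "arithmetical (renS r A) = arithmetical A"
  by (induction A arbitrary: r) auto

lemma fsv_renS_arithmetical: "arithmetical A \<Longrightarrow> fsv (renS r A) = r ` fsv A"
  by (induction A arbitrary: r) auto

lemma wf_fm_renS [simp]: "wf_fm (renS r A) = wf_fm A"
  by (induction A arbitrary: r) auto

lemma wf_sub_trm: "wf_trm t \<Longrightarrow> (\<And>i. wf_trm (s i)) \<Longrightarrow> wf_trm (sub_trm s t)"
  by (induction t) auto

lemma wf_up: "(\<And>i. wf_trm (s i)) \<Longrightarrow> wf_trm (up s i)"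
  by (auto simp: up_def lift_trm_def intro!: wf_sub_trm split: nat.splits)

lemma wf_fm_sub: "wf_fm A \<Longrightarrow> (\<And>i. wf_trm (s i)) \<Longrightarrow> wf_fm (sub s A)"
  by (induction A arbitrary: s) (auto simp: wf_sub_trm wf_up)

lemma lang2_simps [simp]:
  "Neg A \<in> lang2 \<longleftrightarrow> A \<in> lang2"
  "Conj A B \<in> lang2 \<longleftrightarrow> A \<in> lang2 \<and> B \<in> lang2"
  "Disj A B \<in> lang2 \<longleftrightarrow> A \<in> lang2 \<and> B \<in> lang2"
  "Forall A \<in> lang2 \<longleftrightarrow> A \<in> lang2"
  "Exists A \<in> lang2 \<longleftrightarrow> A \<in> lang2"
  "ForallS A \<in> lang2 \<longleftrightarrow> A \<in> lang2"
  "ExistsS A \<in> lang2 \<longleftrightarrow> A \<in> lang2"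
  "Eq s t \<in> lang2 \<longleftrightarrow> wf_trm s \<and> wf_trm t"
  "Less s t \<in> lang2 \<longleftrightarrow> wf_trm s \<and> wf_trm t"
  "SVar i t \<in> lang2 \<longleftrightarrow> wf_trm t"
  "RPred \<phi> t \<notin> lang2"
  "renS r A \<in> lang2 \<longleftrightarrow> A \<in> lang2"
  by (auto simp: lang2_def)

lemma lang2_sub: "A \<in> lang2 \<Longrightarrow> (\<And>i. wf_trm (s i)) \<Longrightarrow> sub s A \<in> lang2"
  by (auto simp: lang2_def wf_fm_sub)

lemma lang2_inst: "A \<in> lang2 \<Longrightarrow> wf_trm t \<Longrightarrow> inst A t \<in> lang2"
  unfolding inst_def by (rule lang2_sub) (auto split: nat.splits)

lemma lang2_lift [simp]: "A \<in> lang2 \<Longrightarrow> lift A \<in> lang2"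
  unfolding lift_def by (rule lang2_sub) auto

lemma lang2_instS [simp]: "A \<in> lang2 \<Longrightarrow> instS A j \<in> lang2"
  by (simp add: instS_def)

lemma inst_simps:
  "inst (Eq s t) u = Eq (sub_trm (case_nat u Var) s) (sub_trm (case_nat u Var) t)"
  "inst (Less s t) u = Less (sub_trm (case_nat u Var) s) (sub_trm (case_nat u Var) t)"
  "inst (SVar i t) u = SVar i (sub_trm (case_nat u Var) t)"
  by (simp_all add: inst_def)

lemma wf_lift_trm [simp]: "wf_trm t \<Longrightarrow> wf_trm (lift_trm t)"
  by (simp add: lift_trm_def wf_sub_trm)

lemma finite_fv_trm: "finite (fv_trm t)"
  by (induction t) auto

lemma finite_fv: "finite (fv A)"
proof (induction A)
  case (Forall A)
  have "{i. Suc i \<in> fv A} = Suc -` fv A" by auto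
  with Forall show ?case by (simp add: finite_vimageI)
next
  case (Exists A)
  have "{i. Suc i \<in> fv A} = Suc -` fv A" by auto
  with Exists show ?case by (simp add: finite_vimageI)
qed (auto simp: finite_fv_trm)

lemma finite_fsv: "finite (fsv A)"
proof (induction A)
  case (ForallS A)
  have "{i. Suc i \<in> fsv A} = Suc -` fsv A" by auto
  with ForallS show ?case by (simp add: finite_vimageI)
next
  case (ExistsS A)
  have "{i. Suc i \<in> fsv A} = Suc -` fsv A" by auto
  with ExistsS show ?case by (simp add: finite_vimageI)
qed auto

lemma obtain_bound:
  assumes "finite (S :: nat set)"
  obtains n where "\<And>i. i \<in> S \<Longrightarrow> i < n"
  using finite_nat_set_iff_bounded[of S] assms by auto

section \<open>Henkin semantics\<close>

text \<open>
  One notion of structure serves both settings.  Equality denotes identity.  Set quantifiers range over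
  \<open>Sets M\<close>, an arbitrary collection, so no comprehension is valid in general; \<open>Rel M\<close> interprets the \<open>R\<^sub>\<phi>\<close>.
\<close>

record 'd model =
  Fun :: "efun \<Rightarrow> 'd list \<Rightarrow> 'd"
  Lt :: "'d \<Rightarrow> 'd \<Rightarrow> bool"
  Sets :: "'d set set"
  Rel :: "fm \<Rightarrow> 'd set"

fun eval :: "'d model \<Rightarrow> (nat \<Rightarrow> 'd) \<Rightarrow> trm \<Rightarrow> 'd" where
  "eval M e (Var i) = e i"
| "eval M e (Fn f ts) = Fun M f (map (eval M e) ts)"

primrec sat :: "'d model \<Rightarrow> (nat \<Rightarrow> 'd) \<Rightarrow> (nat \<Rightarrow> 'd set) \<Rightarrow> fm \<Rightarrow> bool" where
  "sat M e E (Eq s t) \<longleftrightarrow> eval M e s = eval M e t"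
| "sat M e E (Less s t) \<longleftrightarrow> Lt M (eval M e s) (eval M e t)"
| "sat M e E (SVar i t) \<longleftrightarrow> eval M e t \<in> E i"
| "sat M e E (RPred \<phi> t) \<longleftrightarrow> eval M e t \<in> Rel M \<phi>"
| "sat M e E (Neg A) \<longleftrightarrow> \<not> sat M e E A"
| "sat M e E (Conj A B) \<longleftrightarrow> sat M e E A \<and> sat M e E B"
| "sat M e E (Disj A B) \<longleftrightarrow> sat M e E A \<or> sat M e E B"
| "sat M e E (Forall A) \<longleftrightarrow> (\<forall>d. sat M (case_nat d e) E A)"
| "sat M e E (Exists A) \<longleftrightarrow> (\<exists>d. sat M (case_nat d e) E A)"
| "sat M e E (ForallS A) \<longleftrightarrow> (\<forall>X\<in>Sets M. sat M e (case_nat X E) A)"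
| "sat M e E (ExistsS A) \<longleftrightarrow> (\<exists>X\<in>Sets M. sat M e (case_nat X E) A)"

text \<open>
  Free variables are read universally, as in the axioms of the theories.  The assignments to the set variables
  have to come from \<open>Sets M\<close>.
\<close>

definition valid :: "'d model \<Rightarrow> fm \<Rightarrow> bool" where
  "valid M A \<longleftrightarrow> (\<forall>e E. (\<forall>i. E i \<in> Sets M) \<longrightarrow> sat M e E A)"

lemma eval_sub: "eval M e (sub_trm s t) = eval M (\<lambda>i. eval M e (s i)) t"
  by (induction t) (auto simp: comp_def cong: map_cong)

lemma eval_lift_trm [simp]: "eval M (case_nat d e) (lift_trm t) = eval M e t"
  by (simp add: lift_trm_def eval_sub)

lemma eval_up: "(\<lambda>i. eval M (case_nat d e) (up s i)) = case_nat d (\<lambda>i. eval M e (s i))"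
  by (auto simp: up_def split: nat.splits)

lemma sat_sub: "sat M e E (sub s A) \<longleftrightarrow> sat M (\<lambda>i. eval M e (s i)) E A"
  by (induction A arbitrary: s e E) (simp_all add: eval_sub eval_up)

lemma comp_upS: "(\<lambda>i. (case_nat X E) (upS r i)) = case_nat X (\<lambda>i. E (r i))"
  by (auto simp: upS_def split: nat.splits)

lemma sat_renS: "sat M e E (renS r A) \<longleftrightarrow> sat M e (\<lambda>i. E (r i)) A"
  by (induction A arbitrary: r e E) (simp_all add: comp_upS)

lemma sat_inst: "sat M e E (inst A t) \<longleftrightarrow> sat M (case_nat (eval M e t) e) E A"
proof -
  have "(\<lambda>i. eval M e (case_nat t Var i)) = case_nat (eval M e t) e"
    by (auto split: nat.splits)
  then show ?thesis by (simp add: inst_def sat_sub)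
qed

lemma sat_lift: "sat M (case_nat d e) E (lift A) \<longleftrightarrow> sat M e E A"
  by (simp add: lift_def sat_sub)

lemma sat_lift1: "sat M (case_nat d (case_nat d' e)) E (lift1 A) \<longleftrightarrow> sat M (case_nat d e) E A"
proof -
  have "(\<lambda>i. eval M (case_nat d (case_nat d' e)) (case_nat (Var 0) (\<lambda>i. Var (Suc (Suc i))) i))
      = case_nat d e"
    by (auto split: nat.splits)
  then show ?thesis by (simp add: lift1_def sat_sub)
qed

lemma sat_instS: "sat M e E (instS A j) \<longleftrightarrow> sat M e (case_nat (E j) E) A"
proof -
  have "(\<lambda>i. E (case_nat j (\<lambda>i. i) i)) = case_nat (E j) E"
    by (auto split: nat.splits)
  then show ?thesis by (simp add: instS_def sat_renS)
qed

lemma sat_liftS: "sat M e (case_nat X E) (liftS A) \<longleftrightarrow> sat M e E A"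
  by (simp add: liftS_def sat_renS)

lemma eval_cong: "(\<And>i. i \<in> fv_trm t \<Longrightarrow> e i = e' i) \<Longrightarrow> eval M e t = eval M e' t"
proof (induction t)
  case (Fn f ts)
  have "map (eval M e) ts = map (eval M e') ts"
    using Fn.prems by (auto intro!: Fn.IH)
  then show ?case by (simp only: eval.simps)
qed simp

lemma sat_cong:
  assumes "\<And>i. i \<in> fv A \<Longrightarrow> e i = e' i" and "\<And>i. i \<in> fsv A \<Longrightarrow> E i = E' i"
  shows "sat M e E A \<longleftrightarrow> sat M e' E' A"
  using assms
proof (induction A arbitrary: e e' E E')
  case (Eq s t)
  have "eval M e s = eval M e' s" "eval M e t = eval M e' t"
    using Eq.prems by (auto intro!: eval_cong)
  then show ?case by simp
next
  case (Less s t)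
  have "eval M e s = eval M e' s" "eval M e t = eval M e' t"
    using Less.prems by (auto intro!: eval_cong)
  then show ?case by simp
next
  case (SVar i t)
  have "eval M e t = eval M e' t" using SVar.prems by (auto intro!: eval_cong)
  then show ?case using SVar.prems by simp
next
  case (RPred \<phi> t)
  have "eval M e t = eval M e' t" using RPred.prems by (auto intro!: eval_cong)
  then show ?case by simp
next
  case (Neg A)
  have "sat M e E A \<longleftrightarrow> sat M e' E' A" using Neg.prems by (intro Neg.IH) auto
  then show ?case by simp
next
  case (Conj A B)
  have "sat M e E A \<longleftrightarrow> sat M e' E' A" "sat M e E B \<longleftrightarrow> sat M e' E' B"
    using Conj.prems by (intro Conj.IH; auto)+
  then show ?case by simp
next
  case (Disj A B)
  have "sat M e E A \<longleftrightarrow> sat M e' E' A" "sat M e E B \<longleftrightarrow> sat M e' E' B"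
    using Disj.prems by (intro Disj.IH; auto)+
  then show ?case by simp
next
  case (Forall A)
  have "sat M (case_nat d e) E A \<longleftrightarrow> sat M (case_nat d e') E' A" for d
    using Forall.prems by (intro Forall.IH) (auto split: nat.splits)
  then show ?case by simp
next
  case (Exists A)
  have "sat M (case_nat d e) E A \<longleftrightarrow> sat M (case_nat d e') E' A" for d
    using Exists.prems by (intro Exists.IH) (auto split: nat.splits)
  then show ?case by simp
next
  case (ForallS A)
  have "sat M e (case_nat X E) A \<longleftrightarrow> sat M e' (case_nat X E') A" for X
    using ForallS.prems by (intro ForallS.IH) (auto split: nat.splits)
  then show ?case by simp
next
  case (ExistsS A)
  have "sat M e (case_nat X E) A \<longleftrightarrow> sat M e' (case_nat X E') A" for X
    using ExistsS.prems by (intro ExistsS.IH) (auto split: nat.splits)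
  then show ?case by simp
qed

lemma eval_Rel_update [simp]: "eval (M\<lparr>Rel := r\<rparr>) e t = eval M e t"
proof (induction t)
  case (Fn f ts)
  then have "map (eval (M\<lparr>Rel := r\<rparr>) e) ts = map (eval M e) ts" by simp
  then show ?case by (simp only: eval.simps) simp
qed simp

lemma sat_Rel_update: "preds A = {} \<Longrightarrow> sat (M\<lparr>Rel := r\<rparr>) e E A \<longleftrightarrow> sat M e E A"
  by (induction A arbitrary: e E) auto

lemma sat_mono:
  assumes "arithmetical A" and "\<And>j. j \<noteq> i \<Longrightarrow> E j = E' j" and "E i \<subseteq> E' i"
  shows "(occurs_only True i A \<longrightarrow> sat M e E A \<longrightarrow> sat M e E' A) \<and>
    (occurs_only False i A \<longrightarrow> sat M e E' A \<longrightarrow> sat M e E A)"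
  using assms(1)
proof (induction A arbitrary: e)
  case (SVar j t)
  show ?case using assms(2)[of j] assms(3) by (cases "j = i") auto
qed (simp_all, (meson | blast)+)

text \<open>
  Replacing \<open>X\<^sub>i\<close> by \<open>\<sigma>\<close> amounts to assigning to \<open>X\<^sub>i\<close> the extension of \<open>\<sigma>\<close>, which need not belong to \<open>Sets M\<close>.
\<close>

lemma sat_repl:
  "arithmetical A \<Longrightarrow>
    sat M e E (repl i \<sigma> A) \<longleftrightarrow> sat M e (E(i := {d. sat M (case_nat d e) E \<sigma>})) A"
  by (induction A arbitrary: e \<sigma>) (auto simp: sat_inst sat_lift1)

lemma pval_sat: "pval (sat M e E) A \<longleftrightarrow> sat M e E A"
  by (induction A) auto

theorem soundness:
  assumes "provable L T A" and "\<And>A. A \<in> T \<Longrightarrow> A \<in> L \<Longrightarrow> valid M A"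
  shows "valid M A"
  using assms(1)
proof induction
  case (Ax A) then show ?case by (rule assms(2))
next
  case (Taut A)
  then show ?case by (auto simp: valid_def pval_sat[symmetric])
next
  case (MP A B) then show ?case by (simp add: valid_def)
next
  case (AllSI B A)
  show ?case unfolding valid_def
  proof (intro allI impI)
    fix e :: "nat \<Rightarrow> 'a" and E :: "nat \<Rightarrow> 'a set" assume E: "\<forall>i. E i \<in> Sets M"
    have "sat M e (case_nat X E) (Imp (liftS B) A)" if "X \<in> Sets M" for X
      using AllSI.IH E that by (auto simp: valid_def split: nat.splits)
    then show "sat M e E (Imp B (ForallS A))" by (auto simp: sat_liftS)
  qed
next
  case (ExSE A B)
  show ?case unfolding valid_def
  proof (intro allI impI)
    fix e :: "nat \<Rightarrow> 'a" and E :: "nat \<Rightarrow> 'a set" assume E: "\<forall>i. E i \<in> Sets M"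
    have "sat M e (case_nat X E) (Imp A (liftS B))" if "X \<in> Sets M" for X
      using ExSE.IH E that by (auto simp: valid_def split: nat.splits)
    then show "sat M e E (Imp (ExistsS A) B)" by (auto simp: sat_liftS)
  qed
next
  case (AllI B A)
  show ?case unfolding valid_def
  proof (intro allI impI)
    fix e :: "nat \<Rightarrow> 'a" and E :: "nat \<Rightarrow> 'a set" assume E: "\<forall>i. E i \<in> Sets M"
    have "sat M (case_nat d e) E (Imp (lift B) A)" for d
      using AllI.IH E by (auto simp: valid_def)
    then show "sat M e E (Imp B (Forall A))" by (auto simp: sat_lift)
  qed
next
  case (ExE A B)
  show ?case unfolding valid_def
  proof (intro allI impI)
    fix e :: "nat \<Rightarrow> 'a" and E :: "nat \<Rightarrow> 'a set" assume E: "\<forall>i. E i \<in> Sets M"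
    have "sat M (case_nat d e) E (Imp A (lift B))" for d
      using ExE.IH E by (auto simp: valid_def)
    then show "sat M e E (Imp (Exists A) B)" by (auto simp: sat_lift)
  qed
qed (auto simp: valid_def sat_inst sat_instS)

section \<open>Derived rules of the calculus\<close>

abbreviation prv :: "fm set \<Rightarrow> fm \<Rightarrow> bool" where
  "prv \<equiv> provable lang2"

lemma provable_in_language: "provable L T A \<Longrightarrow> A \<in> L"
  by (induction rule: provable.induct) auto

lemma taut1:
  assumes "prv T A" and "\<And>v. pval v A \<Longrightarrow> pval v B" and "B \<in> lang2"
  shows "prv T B"
proof -
  have "prv T (Imp A B)"
    using assms provable_in_language[OF assms(1)] by (intro Taut) auto
  then show ?thesis using assms by (blast intro: MP)
qed

lemma taut2:
  assumes "prv T A" and "prv T B" and "\<And>v. pval v A \<Longrightarrow> pval v B \<Longrightarrow> pval v C" and "C \<in> lang2"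
  shows "prv T C"
proof -
  have "prv T (Imp B C)"
    using assms provable_in_language[OF assms(2)] by (intro taut1[OF assms(1)]) auto
  then show ?thesis using assms by (blast intro: MP)
qed

lemma lift_closed [simp]: "lift (Eq tzero tzero) = Eq tzero tzero"
  by (simp add: lift_def)

lemma liftS_closed [simp]: "liftS (Eq tzero tzero) = Eq tzero tzero"
  by (simp add: liftS_def)

text \<open>
  A provable sentence that can be put as premise where the rules for universal quantifiers demand one.
\<close>

lemma prv_true: "prv T (Eq tzero tzero)"
  by (rule EqRefl) simp

lemma prv_Forall: "prv T A \<Longrightarrow> prv T (Forall A)"
proof -
  assume A: "prv T A"
  note L = provable_in_language[OF A]
  have "prv T (Imp (lift (Eq tzero tzero)) A)" by (rule taut1[OF A]) (use L in auto)
  then have "prv T (Imp (Eq tzero tzero) (Forall A))" by (rule AllI) (use L in auto)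
  with prv_true show ?thesis by (rule MP) (use L in auto)
qed

lemma prv_ForallS: "prv T A \<Longrightarrow> prv T (ForallS A)"
proof -
  assume A: "prv T A"
  note L = provable_in_language[OF A]
  have "prv T (Imp (liftS (Eq tzero tzero)) A)" by (rule taut1[OF A]) (use L in auto)
  then have "prv T (Imp (Eq tzero tzero) (ForallS A))" by (rule AllSI) (use L in auto)
  with prv_true show ?thesis by (rule MP) (use L in auto)
qed

lemma prv_AllE:
  assumes "prv T (Forall A)" and "wf_trm t"
  shows "prv T (inst A t)"
  by (rule MP[OF assms(1) AllE])
    (use assms provable_in_language[OF assms(1)] in \<open>auto simp: lang2_inst\<close>)

lemma prv_AllSE:
  assumes "prv T (ForallS A)"
  shows "prv T (instS A j)"
  by (rule MP[OF assms AllSE]) (use provable_in_language[OF assms] in auto)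

lemma fv_Foralls: "fv ((Forall ^^ n) A) = {i. i + n \<in> fv A}"
  by (induction n) auto

lemma fsv_ForallSs: "fsv ((ForallS ^^ n) A) = {i. i + n \<in> fsv A}"
  by (induction n) auto

lemma prv_Foralls: "prv T A \<Longrightarrow> prv T ((Forall ^^ n) A)"
  by (induction n) (auto intro: prv_Forall)

lemma prv_ForallSs: "prv T A \<Longrightarrow> prv T ((ForallS ^^ n) A)"
  by (induction n) (auto intro: prv_ForallS)

lemma case_nat_eta: "case_nat (s 0) (\<lambda>i. s (Suc i)) = s"
  by (auto split: nat.splits)

text \<open>
  The outermost of \<open>n\<close> quantifiers is instantiated first, by the term for the last variable; the hypothesis
  speaks of all \<open>s\<close> so that the substitution can be extended one variable at a time.
\<close>

lemma prv_sub_Foralls: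
  "(\<And>s. \<forall>i. wf_trm (s i) \<Longrightarrow> prv T (sub s ((Forall ^^ n) A))) \<Longrightarrow> \<forall>i. wf_trm (s i) \<Longrightarrow>
    prv T (sub s A)"
proof (induction n arbitrary: A s)
  case (Suc n)
  have "prv T (sub (\<lambda>i. s (Suc i)) (Forall A))"
    by (rule Suc.IH) (use Suc.prems in \<open>simp_all add: funpow_Suc_right del: funpow.simps\<close>)
  then have "prv T (inst (sub (up (\<lambda>i. s (Suc i))) A) (s 0))"
    by (intro prv_AllE) (use Suc.prems in simp_all)
  then show ?case by (simp add: inst_sub_up case_nat_eta)
qed simp

text \<open>
  The calculus has no substitution rule.  Instead, all variables are generalized, which turns \<open>A\<close> into a
  sentence on which every substitution acts trivially, and the quantifiers are then instantiated.
\<close>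

lemma prv_sub:
  assumes "prv T A" and "\<And>i. wf_trm (s i)"
  shows "prv T (sub s A)"
proof -
  obtain n where n: "\<And>i. i \<in> fv A \<Longrightarrow> i < n" using obtain_bound[OF finite_fv] by metis
  have "sub s' ((Forall ^^ n) A) = sub Var ((Forall ^^ n) A)" for s'
    using n by (intro sub_cong) (fastforce simp: fv_Foralls)
  then have "prv T (sub s' ((Forall ^^ n) A))" for s'
    using prv_Foralls[OF assms(1)] by simp
  then show ?thesis using prv_sub_Foralls assms(2) by blast
qed

lemma prv_renS_ForallSs:
  "(\<And>r. prv T (renS r ((ForallS ^^ n) A))) \<Longrightarrow> prv T (renS r A)"
proof (induction n arbitrary: A r)
  case (Suc n)
  have "prv T (renS (\<lambda>i. r (Suc i)) (ForallS A))"
    by (rule Suc.IH) (use Suc.prems in \<open>simp add: funpow_Suc_right del: funpow.simps\<close>)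
  then have "prv T (instS (renS (upS (\<lambda>i. r (Suc i))) A) (r 0))"
    by (intro prv_AllSE) simp
  then show ?case by (simp add: instS_renS_upS case_nat_eta)
qed simp

lemma prv_renS:
  assumes "prv T A"
  shows "prv T (renS r A)"
proof -
  obtain n where n: "\<And>i. i \<in> fsv A \<Longrightarrow> i < n" using obtain_bound[OF finite_fsv] by metis
  have "renS r' ((ForallS ^^ n) A) = renS (\<lambda>i. i) ((ForallS ^^ n) A)" for r'
    using n by (intro renS_cong) (fastforce simp: fsv_ForallSs)
  then have "prv T (renS r' ((ForallS ^^ n) A))" for r'
    using prv_ForallSs[OF assms] by simp
  then show ?thesis by (rule prv_renS_ForallSs)
qed

section \<open>Extension to a Henkin set\<close>

text \<open>
  The finitely many formulas added to \<open>T\<close> at a given stage are represented by their conjunction.  A finite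
  stage always leaves variables fresh, which therefore can serve as Henkin constants.
\<close>

definition consistent :: "fm set \<Rightarrow> fm \<Rightarrow> bool" where
  "consistent T B \<longleftrightarrow> B \<in> lang2 \<and> \<not> prv T (Neg B)"

text \<open>
  A fresh \<open>v\<close> can be turned into the bound variable \<open>0\<close> by a substitution that merely lifts the side formula.
  This converts a derivation about the witness \<open>v\<close> into a premise of the rules \<open>ExE\<close> and \<open>AllI\<close>; likewise for
  set variables.
\<close>

lemma fresh_number_variable:
  obtains v s where "\<And>i. wf_trm (s i)" and "sub s (inst D (Var v)) = D" and "sub s B = lift B"
proof -
  obtain v where v: "\<And>i. i \<in> fv (Conj B (Exists D)) \<Longrightarrow> i < v"
    using obtain_bound[OF finite_fv] by metis
  define s where "s = (\<lambda>i. if i = v then Var 0 else Var (Suc i))"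
  show ?thesis
  proof
    show "wf_trm (s i)" for i by (simp add: s_def)
    have "sub s (inst D (Var v)) = sub Var D"
      unfolding inst_def sub_comp
      by (rule sub_cong) (use v in \<open>auto simp: s_def split: nat.splits\<close>)
    then show "sub s (inst D (Var v)) = D" by simp
    show "sub s B = lift B"
      unfolding lift_def by (rule sub_cong) (use v in \<open>auto simp: s_def\<close>)
  qed
qed

lemma fresh_set_variable:
  obtains v r where "renS r (instS D v) = D" and "renS r B = liftS B"
proof -
  obtain v where v: "\<And>i. i \<in> fsv (Conj B (ExistsS D)) \<Longrightarrow> i < v"
    using obtain_bound[OF finite_fsv] by metis
  define r where "r = (\<lambda>i. if i = v then 0 else Suc i)"
  show ?thesis
  proof
    have "renS r (instS D v) = renS (\<lambda>i. i) D"
      unfolding instS_def renS_comp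
      by (rule renS_cong) (use v in \<open>auto simp: r_def split: nat.splits\<close>)
    then show "renS r (instS D v) = D" by simp
    show "renS r B = liftS B"
      unfolding liftS_def by (rule renS_cong) (use v in \<open>auto simp: r_def\<close>)
  qed
qed

lemma Exists_witness:
  assumes B: "consistent T B" and D: "prv T (Imp B (Exists D))"
  shows "\<exists>v. consistent T (Conj B (inst D (Var v)))"
proof (rule ccontr)
  note L = provable_in_language[OF D]
  obtain v s where s: "\<And>i. wf_trm (s i)" "sub s (inst D (Var v)) = D" "sub s B = lift B"
    using fresh_number_variable by blast
  assume "\<nexists>v. consistent T (Conj B (inst D (Var v)))"
  then have "prv T (Neg (Conj B (inst D (Var v))))"
    using L by (auto simp: consistent_def lang2_inst)
  then have "prv T (Imp (inst D (Var v)) (Neg B))"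
    by (rule taut1) (use L in \<open>auto simp: lang2_inst\<close>)
  then have "prv T (sub s (Imp (inst D (Var v)) (Neg B)))"
    using s(1) by (rule prv_sub)
  then have "prv T (Imp D (lift (Neg B)))"
    by (simp add: s(2,3)) (simp add: lift_def)
  then have "prv T (Imp (Exists D) (Neg B))"
    by (rule ExE) (use L in auto)
  from taut2[OF this D, of "Neg B"] have "prv T (Neg B)" using L by auto
  with B show False by (simp add: consistent_def)
qed

lemma Forall_counterexample:
  assumes B: "consistent T B" and D: "prv T (Imp B (Neg (Forall D)))"
  shows "\<exists>v. consistent T (Conj B (Neg (inst D (Var v))))"
proof (rule ccontr)
  note L = provable_in_language[OF D]
  obtain v s where s: "\<And>i. wf_trm (s i)" "sub s (inst D (Var v)) = D" "sub s B = lift B"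
    using fresh_number_variable by blast
  assume "\<nexists>v. consistent T (Conj B (Neg (inst D (Var v))))"
  then have "prv T (Neg (Conj B (Neg (inst D (Var v)))))"
    using L by (auto simp: consistent_def lang2_inst)
  then have "prv T (Imp B (inst D (Var v)))"
    by (rule taut1) (use L in \<open>auto simp: lang2_inst\<close>)
  then have "prv T (sub s (Imp B (inst D (Var v))))"
    using s(1) by (rule prv_sub)
  then have "prv T (Imp (lift B) D)"
    by (simp add: s(2,3))
  then have "prv T (Imp B (Forall D))"
    by (rule AllI) (use L in auto)
  from taut2[OF this D, of "Neg B"] have "prv T (Neg B)" using L by auto
  with B show False by (simp add: consistent_def)
qed

lemma ExistsS_witness:
  assumes B: "consistent T B" and D: "prv T (Imp B (ExistsS D))"
  shows "\<exists>v. consistent T (Conj B (instS D v))"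
proof (rule ccontr)
  note L = provable_in_language[OF D]
  obtain v r where r: "renS r (instS D v) = D" "renS r B = liftS B"
    using fresh_set_variable by blast
  assume "\<nexists>v. consistent T (Conj B (instS D v))"
  then have "prv T (Neg (Conj B (instS D v)))"
    using L by (auto simp: consistent_def)
  then have "prv T (Imp (instS D v) (Neg B))"
    by (rule taut1) (use L in auto)
  then have "prv T (renS r (Imp (instS D v) (Neg B)))"
    by (rule prv_renS)
  then have "prv T (Imp D (liftS (Neg B)))"
    by (simp add: r) (simp add: liftS_def)
  then have "prv T (Imp (ExistsS D) (Neg B))"
    by (rule ExSE) (use L in auto)
  from taut2[OF this D, of "Neg B"] have "prv T (Neg B)" using L by auto
  with B show False by (simp add: consistent_def)
qed

lemma ForallS_counterexample:
  assumes B: "consistent T B" and D: "prv T (Imp B (Neg (ForallS D)))"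
  shows "\<exists>v. consistent T (Conj B (Neg (instS D v)))"
proof (rule ccontr)
  note L = provable_in_language[OF D]
  obtain v r where r: "renS r (instS D v) = D" "renS r B = liftS B"
    using fresh_set_variable by blast
  assume "\<nexists>v. consistent T (Conj B (Neg (instS D v)))"
  then have "prv T (Neg (Conj B (Neg (instS D v))))"
    using L by (auto simp: consistent_def)
  then have "prv T (Imp B (instS D v))"
    by (rule taut1) (use L in auto)
  then have "prv T (renS r (Imp B (instS D v)))"
    by (rule prv_renS)
  then have "prv T (Imp (liftS B) D)"
    by (simp add: r)
  then have "prv T (Imp B (ForallS D))"
    by (rule AllSI) (use L in auto)
  from taut2[OF this D, of "Neg B"] have "prv T (Neg B)" using L by auto
  with B show False by (simp add: consistent_def)
qed

text \<open>
  \<open>P\<close> contains a witness for \<open>C\<close>, if \<open>C\<close> is an existential claim of one of the four possible kinds.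
\<close>

definition witnessed :: "(fm \<Rightarrow> bool) \<Rightarrow> fm \<Rightarrow> bool" where
  "witnessed P C \<longleftrightarrow>
     (\<forall>D. C = Exists D \<longrightarrow> (\<exists>v. P (inst D (Var v)))) \<and>
     (\<forall>D. C = Neg (Forall D) \<longrightarrow> (\<exists>v. P (Neg (inst D (Var v))))) \<and>
     (\<forall>D. C = ExistsS D \<longrightarrow> (\<exists>v. P (instS D v))) \<and>
     (\<forall>D. C = Neg (ForallS D) \<longrightarrow> (\<exists>v. P (Neg (instS D v))))"

lemma witnessed_mono: "witnessed P C \<Longrightarrow> (\<And>A. P A \<Longrightarrow> Q A) \<Longrightarrow> witnessed Q C"
  unfolding witnessed_def by blast

lemma witnessed_trivial:
  assumes "\<nexists>D. C = Exists D \<or> C = Neg (Forall D) \<or> C = ExistsS D \<or> C = Neg (ForallS D)"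
  shows "witnessed P C"
  using assms unfolding witnessed_def by blast

lemma add_witness:
  assumes B: "consistent T B" and C: "prv T (Imp B C)"
  shows "\<exists>B'. consistent T B' \<and> prv T (Imp B' B) \<and> witnessed (\<lambda>A. prv T (Imp B' A)) C"
proof -
  have conj: "prv T (Imp (Conj B W) B) \<and> prv T (Imp (Conj B W) W)" if "consistent T (Conj B W)" for W
    using that by (auto simp: consistent_def intro!: Taut)
  have BL: "B \<in> lang2" using B by (simp add: consistent_def)
  consider (ex) D where "C = Exists D" | (all) D where "C = Neg (Forall D)"
    | (exS) D where "C = ExistsS D" | (allS) D where "C = Neg (ForallS D)"
    | (triv) "\<nexists>D. C = Exists D \<or> C = Neg (Forall D) \<or> C = ExistsS D \<or> C = Neg (ForallS D)"
    by blast
  then show ?thesis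
  proof cases
    case (ex D)
    with Exists_witness[OF B] C obtain v where "consistent T (Conj B (inst D (Var v)))" by auto
    with conj ex show ?thesis unfolding witnessed_def by blast
  next
    case (all D)
    with Forall_counterexample[OF B] C obtain v
      where "consistent T (Conj B (Neg (inst D (Var v))))" by auto
    with conj all show ?thesis unfolding witnessed_def by blast
  next
    case (exS D)
    with ExistsS_witness[OF B] C obtain v where "consistent T (Conj B (instS D v))" by auto
    with conj exS show ?thesis unfolding witnessed_def by blast
  next
    case (allS D)
    with ForallS_counterexample[OF B] C obtain v
      where "consistent T (Conj B (Neg (instS D v)))" by auto
    with conj allS show ?thesis unfolding witnessed_def by blast
  next
    case triv
    have "prv T (Imp B B)" using BL by (auto intro: Taut)
    with B witnessed_trivial[OF triv] show ?thesis by blast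
  qed
qed

lemma decide:
  assumes B: "consistent T B" and C: "C \<in> lang2"
  shows "\<exists>B'. consistent T B' \<and> prv T (Imp B' B) \<and>
    (\<exists>C'\<in>{C, Neg C}. prv T (Imp B' C') \<and> witnessed (\<lambda>A. prv T (Imp B' A)) C')"
proof -
  have BL: "B \<in> lang2" using B by (simp add: consistent_def)
  have "\<exists>C'\<in>{C, Neg C}. consistent T (Conj B C')"
  proof (rule ccontr)
    assume "\<not> ?thesis"
    then have 1: "prv T (Neg (Conj B C))" and 2: "prv T (Neg (Conj B (Neg C)))"
      using BL C by (auto simp: consistent_def)
    have "prv T (Neg B)" by (rule taut2[OF 1 2]) (use BL in auto)
    with B show False by (simp add: consistent_def)
  qed
  then obtain C' where C': "C' \<in> {C, Neg C}" and C'_consistent: "consistent T (Conj B C')" by blast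
  have C'L: "C' \<in> lang2" using C' C by auto
  have imp: "prv T (Imp (Conj B C') C')" "prv T (Imp (Conj B C') B)"
    using BL C'L by (auto intro!: Taut)
  obtain B' where B': "consistent T B'" "prv T (Imp B' (Conj B C'))"
      "witnessed (\<lambda>A. prv T (Imp B' A)) C'"
    using add_witness[OF C'_consistent imp(1)] by blast
  have "B' \<in> lang2" using B' by (simp add: consistent_def)
  then have "prv T (Imp B' B)" "prv T (Imp B' C')"
    using taut1[OF B'(2)] BL C'L by auto
  with B' C' show ?thesis by blast
qed

instance efun :: countable by countable_datatype
instance trm :: countable by countable_datatype
instance fm :: countable by countable_datatype

text \<open>
  What the finished set has to satisfy for its terms and set variables to form a model.
\<close>

locale henkin_set =
  fixes T \<Delta> :: "fm set"
  assumes language: "A \<in> \<Delta> \<Longrightarrow> A \<in> lang2"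
    and theorems: "prv T A \<Longrightarrow> A \<in> \<Delta>"
    and mp: "Imp A B \<in> \<Delta> \<Longrightarrow> A \<in> \<Delta> \<Longrightarrow> B \<in> \<Delta>"
    and complete: "A \<in> lang2 \<Longrightarrow> Neg A \<in> \<Delta> \<longleftrightarrow> A \<notin> \<Delta>"
    and witnesses: "A \<in> \<Delta> \<Longrightarrow> witnessed (\<lambda>B. B \<in> \<Delta>) A"

text \<open>
  Stage \<open>n + 1\<close> decides the \<open>n\<close>-th formula and adds a witness if one is called for.  The limit consists of
  everything that follows from some stage.
\<close>

lemma Lindenbaum:
  assumes "consistent T B"
  shows "\<exists>\<Delta>. henkin_set T \<Delta> \<and> B \<in> \<Delta>"
proof -
  define Q where "Q n B B' \<longleftrightarrow> prv T (Imp B' B) \<and> (from_nat n \<in> lang2 \<longrightarrow>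
    (\<exists>C'\<in>{from_nat n, Neg (from_nat n)}. prv T (Imp B' C') \<and> witnessed (\<lambda>A. prv T (Imp B' A)) C'))"
    for n B B'
  have step: "\<exists>B'. consistent T B' \<and> Q n B B'" if "consistent T B" for n B
  proof (cases "from_nat n \<in> lang2")
    case True
    with decide[OF that] show ?thesis unfolding Q_def by blast
  next
    case False
    have "prv T (Imp B B)" using that by (auto simp: consistent_def intro: Taut)
    with False that show ?thesis unfolding Q_def by blast
  qed
  have "\<exists>f. \<forall>n. (consistent T (f n) \<and> (n = 0 \<longrightarrow> f n = B)) \<and> Q n (f n) (f (Suc n))"
  proof (rule dependent_nat_choice)
    show "\<exists>x. consistent T x \<and> (0 = 0 \<longrightarrow> x = B)" using assms by blast
    show "\<exists>y. (consistent T y \<and> (Suc n = 0 \<longrightarrow> y = B)) \<and> Q n x y"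
      if "consistent T x \<and> (n = 0 \<longrightarrow> x = B)" for x n
      using step[of x n] that by blast
  qed
  then obtain f where consistent: "\<And>n. consistent T (f n)" and f0: "f 0 = B"
    and Q: "\<And>n. Q n (f n) (f (Suc n))"
    by blast
  have fL: "f n \<in> lang2" for n using consistent by (simp add: consistent_def)
  have mono: "prv T (Imp (f (m + n)) (f m))" for m n
  proof (induction n)
    case 0
    show ?case using fL by (auto intro: Taut)
  next
    case (Suc n)
    have "prv T (Imp (f (Suc (m + n))) (f (m + n)))" using Q by (simp add: Q_def)
    from taut2[OF this Suc] show ?case using fL by auto
  qed
  define \<Delta> where "\<Delta> = {A. \<exists>n. prv T (Imp (f n) A)}"
  have L: "A \<in> lang2" if "A \<in> \<Delta>" for A
    using that provable_in_language by (fastforce simp: \<Delta>_def)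
  have prove: "A \<in> \<Delta>" if "prv T A" for A
    using taut1[OF that, of "Imp (f 0) A"] fL provable_in_language[OF that] by (auto simp: \<Delta>_def)
  have common: "\<exists>n. prv T (Imp (f n) A) \<and> prv T (Imp (f n) B)" if AB: "A \<in> \<Delta>" "B \<in> \<Delta>" for A B
  proof -
    obtain m n where m: "prv T (Imp (f m) A)" and n: "prv T (Imp (f n) B)"
      using AB by (auto simp: \<Delta>_def)
    have "prv T (Imp (f (m + n)) A)"
      by (rule taut2[OF mono[of m n] m]) (use fL L AB in auto)
    moreover have "prv T (Imp (f (m + n)) B)"
      by (rule taut2[OF mono[of n m] n]) (use fL L AB in \<open>auto simp: add.commute\<close>)
    ultimately show ?thesis by blast
  qed
  have mp: "B \<in> \<Delta>" if AB: "Imp A B \<in> \<Delta>" "A \<in> \<Delta>" for A B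
  proof -
    obtain n where "prv T (Imp (f n) (Imp A B))" "prv T (Imp (f n) A)" using common[OF AB] by blast
    from taut2[OF this, of "Imp (f n) B"] have "prv T (Imp (f n) B)" using fL L[OF AB(1)] by auto
    then show ?thesis by (auto simp: \<Delta>_def)
  qed
  have not_both: "Neg A \<notin> \<Delta>" if A: "A \<in> \<Delta>" for A
  proof
    assume "Neg A \<in> \<Delta>"
    with common A obtain n where "prv T (Imp (f n) A)" "prv T (Imp (f n) (Neg A))" by blast
    from taut2[OF this, of "Neg (f n)"] have "prv T (Neg (f n))" using fL by auto
    with consistent show False by (simp add: consistent_def)
  qed
  have decided: "\<exists>C'\<in>{A, Neg A}. C' \<in> \<Delta> \<and> witnessed (\<lambda>B. B \<in> \<Delta>) C'" if A: "A \<in> lang2" for A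
  proof -
    obtain n where n: "A = from_nat n" using from_nat_to_nat by metis
    then obtain C' where "C' \<in> {A, Neg A}" "prv T (Imp (f (Suc n)) C')"
        "witnessed (\<lambda>B. prv T (Imp (f (Suc n)) B)) C'"
      using Q[of n] A unfolding Q_def by blast
    moreover from this(3) have "witnessed (\<lambda>B. B \<in> \<Delta>) C'"
      by (rule witnessed_mono) (auto simp: \<Delta>_def)
    ultimately show ?thesis by (auto simp: \<Delta>_def)
  qed
  have "henkin_set T \<Delta>"
  proof
    show "Neg A \<in> \<Delta> \<longleftrightarrow> A \<notin> \<Delta>" if "A \<in> lang2" for A
      using not_both decided[OF that] by blast
    show "witnessed (\<lambda>B. B \<in> \<Delta>) A" if "A \<in> \<Delta>" for A
      using decided[OF L[OF that]] not_both[OF that] by blast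
  qed (use L prove mp in auto)
  moreover have "prv T (Imp (f 0) B)" using fL f0 by (auto intro: Taut)
  then have "B \<in> \<Delta>" unfolding \<Delta>_def by blast
  ultimately show ?thesis by blast
qed

section \<open>The term model and completeness\<close>

context henkin_set
begin

lemma conseq1:
  assumes "A \<in> \<Delta>" and "\<And>v. pval v A \<Longrightarrow> pval v B" and "B \<in> lang2"
  shows "B \<in> \<Delta>"
  using assms language[OF assms(1)] by (intro mp[OF theorems[OF Taut] assms(1)]) auto

lemma conseq2:
  assumes "A \<in> \<Delta>" and "B \<in> \<Delta>" and "\<And>v. pval v A \<Longrightarrow> pval v B \<Longrightarrow> pval v C" and "C \<in> lang2"
  shows "C \<in> \<Delta>"
  using assms language[OF assms(2)] by (intro mp[OF conseq1[OF assms(1)] assms(2)]) auto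

lemma Conj_mem: "Conj A B \<in> lang2 \<Longrightarrow> Conj A B \<in> \<Delta> \<longleftrightarrow> A \<in> \<Delta> \<and> B \<in> \<Delta>"
  using conseq1[of "Conj A B" A] conseq1[of "Conj A B" B] conseq2[of A B "Conj A B"] by auto

lemma Disj_mem: "Disj A B \<in> lang2 \<Longrightarrow> Disj A B \<in> \<Delta> \<longleftrightarrow> A \<in> \<Delta> \<or> B \<in> \<Delta>"
  using conseq1[of A "Disj A B"] conseq1[of B "Disj A B"] conseq2[of "Disj A B" "Neg A" B]
    complete[of A] by auto

lemma Forall_mem:
  assumes "A \<in> lang2"
  shows "Forall A \<in> \<Delta> \<longleftrightarrow> (\<forall>t. wf_trm t \<longrightarrow> inst A t \<in> \<Delta>)"
proof
  assume "Forall A \<in> \<Delta>"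
  moreover have "Imp (Forall A) (inst A t) \<in> \<Delta>" if "wf_trm t" for t
    using assms that by (intro theorems AllE) (auto simp: lang2_inst)
  ultimately show "\<forall>t. wf_trm t \<longrightarrow> inst A t \<in> \<Delta>" using mp by blast
next
  assume R: "\<forall>t. wf_trm t \<longrightarrow> inst A t \<in> \<Delta>"
  show "Forall A \<in> \<Delta>"
  proof (rule ccontr)
    assume "Forall A \<notin> \<Delta>"
    then obtain v where "Neg (inst A (Var v)) \<in> \<Delta>"
      using witnesses[of "Neg (Forall A)"] complete[of "Forall A"] assms
      by (auto simp: witnessed_def)
    with R complete[of "inst A (Var v)"] assms show False by (auto simp: lang2_inst)
  qed
qed

lemma Exists_mem:
  assumes "A \<in> lang2"
  shows "Exists A \<in> \<Delta> \<longleftrightarrow> (\<exists>t. wf_trm t \<and> inst A t \<in> \<Delta>)"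
proof
  assume "Exists A \<in> \<Delta>"
  then obtain v where "inst A (Var v) \<in> \<Delta>"
    using witnesses[of "Exists A"] by (auto simp: witnessed_def)
  then show "\<exists>t. wf_trm t \<and> inst A t \<in> \<Delta>" by (intro exI[of _ "Var v"]) simp
next
  assume "\<exists>t. wf_trm t \<and> inst A t \<in> \<Delta>"
  then obtain t where "wf_trm t" "inst A t \<in> \<Delta>" by blast
  moreover from this have "Imp (inst A t) (Exists A) \<in> \<Delta>"
    using assms by (intro theorems ExI) (auto simp: lang2_inst)
  ultimately show "Exists A \<in> \<Delta>" using mp by blast
qed

lemma ForallS_mem:
  assumes "A \<in> lang2"
  shows "ForallS A \<in> \<Delta> \<longleftrightarrow> (\<forall>j. instS A j \<in> \<Delta>)"
proof
  assume "ForallS A \<in> \<Delta>"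
  moreover have "Imp (ForallS A) (instS A j) \<in> \<Delta>" for j
    using assms by (intro theorems AllSE) auto
  ultimately show "\<forall>j. instS A j \<in> \<Delta>" using mp by blast
next
  assume R: "\<forall>j. instS A j \<in> \<Delta>"
  show "ForallS A \<in> \<Delta>"
  proof (rule ccontr)
    assume "ForallS A \<notin> \<Delta>"
    then obtain v where "Neg (instS A v) \<in> \<Delta>"
      using witnesses[of "Neg (ForallS A)"] complete[of "ForallS A"] assms
      by (auto simp: witnessed_def)
    with R complete[of "instS A v"] assms show False by auto
  qed
qed

lemma ExistsS_mem:
  assumes "A \<in> lang2"
  shows "ExistsS A \<in> \<Delta> \<longleftrightarrow> (\<exists>j. instS A j \<in> \<Delta>)"
proof
  assume "ExistsS A \<in> \<Delta>"
  then show "\<exists>j. instS A j \<in> \<Delta>"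
    using witnesses[of "ExistsS A"] by (auto simp: witnessed_def)
next
  assume "\<exists>j. instS A j \<in> \<Delta>"
  then obtain j where "instS A j \<in> \<Delta>" by blast
  moreover have "Imp (instS A j) (ExistsS A) \<in> \<Delta>"
    using assms by (intro theorems ExSI) auto
  ultimately show "ExistsS A \<in> \<Delta>" using mp by blast
qed

lemma Leibniz:
  assumes "Eq s t \<in> \<Delta>" and "inst A s \<in> \<Delta>" and "A \<in> lang2"
  shows "inst A t \<in> \<Delta>"
proof -
  have "wf_trm s" "wf_trm t" using language[OF assms(1)] by auto
  then have "Imp (Eq s t) (Imp (inst A s) (inst A t)) \<in> \<Delta>"
    using assms(3) by (intro theorems EqSubst) (auto simp: lang2_inst)
  then show ?thesis using assms mp by blast
qed

lemma Eq_wf: "Eq s t \<in> \<Delta> \<Longrightarrow> wf_trm s \<and> wf_trm t"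
  using language by fastforce

lemma Eq_refl: "wf_trm t \<Longrightarrow> Eq t t \<in> \<Delta>"
  by (intro theorems EqRefl) simp

lemma Eq_sym: "Eq s t \<in> \<Delta> \<Longrightarrow> Eq t s \<in> \<Delta>"
  using Leibniz[of s t "Eq (Var 0) (lift_trm s)"] language[of "Eq s t"] Eq_refl[of s]
  by (simp add: inst_simps sub_trm_lift)

lemma Eq_trans: "Eq s t \<in> \<Delta> \<Longrightarrow> Eq t u \<in> \<Delta> \<Longrightarrow> Eq s u \<in> \<Delta>"
  using Leibniz[of t u "Eq (lift_trm s) (Var 0)"] language[of "Eq s t"]
  by (simp add: inst_simps sub_trm_lift)

text \<open>
  The equality axioms exchange one term at a time.  The arguments \<open>xs\<close> are those already exchanged.
\<close>

lemma Eq_Fn_append: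
  assumes "list_all2 (\<lambda>s t. Eq s t \<in> \<Delta>) ts us"
  shows "wf_efun f \<Longrightarrow> \<forall>x\<in>set xs. wf_trm x \<Longrightarrow> length xs + length ts = arity f \<Longrightarrow>
    Eq (Fn f (xs @ ts)) (Fn f (xs @ us)) \<in> \<Delta>"
  using assms
proof (induction arbitrary: xs rule: list_all2_induct)
  case Nil
  then show ?case by (intro Eq_refl) auto
next
  case (Cons t ts u us)
  have wf: "wf_trm t" "wf_trm u" "\<forall>s\<in>set ts. wf_trm s"
    using Cons.hyps Eq_wf by (fastforce simp: list_all2_conv_all_nth in_set_conv_nth)+
  define A where
    "A = Eq (lift_trm (Fn f (xs @ t # ts))) (Fn f (map lift_trm xs @ Var 0 # map lift_trm ts))"
  have inst: "inst A s = Eq (Fn f (xs @ t # ts)) (Fn f (xs @ s # ts))" for s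
    by (simp add: A_def inst_simps sub_trm_lift comp_def map_idI)
  have whole: "wf_trm (Fn f (xs @ t # ts))" using wf Cons.prems by auto
  have "inst A u \<in> \<Delta>"
  proof (rule Leibniz)
    show "Eq t u \<in> \<Delta>" by fact
    show "inst A t \<in> \<Delta>"
      unfolding inst by (rule Eq_refl) (rule whole)
    show "A \<in> lang2" using wf_lift_trm[OF whole] wf Cons.prems by (auto simp: A_def)
  qed
  moreover have "Eq (Fn f ((xs @ [u]) @ ts)) (Fn f ((xs @ [u]) @ us)) \<in> \<Delta>"
    by (rule Cons.IH) (use Cons.prems wf in auto)
  ultimately show ?case unfolding inst by (auto intro: Eq_trans)
qed

lemma Eq_Fn:
  assumes "list_all2 (\<lambda>s t. Eq s t \<in> \<Delta>) ts us" and "wf_efun f" and "length ts = arity f"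
  shows "Eq (Fn f ts) (Fn f us) \<in> \<Delta>"
  using Eq_Fn_append[OF assms(1,2), of "[]"] assms(3) by simp

definition eq_class :: "trm \<Rightarrow> trm set" where
  "eq_class t = {u. Eq t u \<in> \<Delta>}"

lemma eq_class_eq_iff: "wf_trm s \<Longrightarrow> eq_class s = eq_class t \<longleftrightarrow> Eq s t \<in> \<Delta>"
proof
  assume "wf_trm s" "eq_class s = eq_class t"
  then have "s \<in> eq_class t" using Eq_refl[of s] by (auto simp: eq_class_def)
  then show "Eq s t \<in> \<Delta>" by (simp add: eq_class_def Eq_sym)
next
  assume "Eq s t \<in> \<Delta>"
  then show "eq_class s = eq_class t" unfolding eq_class_def by (blast intro: Eq_sym Eq_trans)
qed

end


fun num :: "nat \<Rightarrow> trm" where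
  "num 0 = tzero"
| "num (Suc n) = tsucc (num n)"

lemma wf_num [simp]: "wf_trm (num n)"
  by (induction n) auto

text \<open>
  Modulo the equations in \<open>\<Delta>\<close> the terms form a countable set, and by the successor axioms an infinite one, since
  numerals are pairwise distinct.  Hence the classes of terms can be numbered by all of \<open>nat\<close>, and the model has
  identity as equality and a whole type as its universe.
\<close>

locale henkin_EA = henkin_set +
  assumes EA: "EA \<subseteq> T"
begin

lemma EA_instances: "A \<in> EA \<Longrightarrow> A \<in> lang2 \<Longrightarrow> (\<And>i. wf_trm (s i)) \<Longrightarrow> sub s A \<in> \<Delta>"
  using EA by (intro theorems prv_sub Ax) auto

lemma num_inject: "Eq (num m) (num n) \<in> \<Delta> \<Longrightarrow> m = n"
proof (induction m arbitrary: n)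
  case 0
  show ?case
  proof (cases n)
    case (Suc k)
    have "Neg (Eq (tsucc (num k)) tzero) \<in> \<Delta>"
      using EA_instances[OF Succ_neq_Zero, of "\<lambda>_. num k"] by simp
    moreover have "Eq (tsucc (num k)) tzero \<in> \<Delta>" using 0 Suc by (simp add: Eq_sym)
    ultimately show ?thesis using complete[of "Eq (tsucc (num k)) tzero"] by simp
  qed simp
next
  case (Suc m)
  show ?case
  proof (cases n)
    case 0
    have "Neg (Eq (tsucc (num m)) tzero) \<in> \<Delta>"
      using EA_instances[OF Succ_neq_Zero, of "\<lambda>_. num m"] by simp
    then show ?thesis using Suc.prems 0 complete[of "Eq (tsucc (num m)) tzero"] by simp
  next
    case (Suc k)
    have "Imp (Eq (tsucc (num m)) (tsucc (num k))) (Eq (num m) (num k)) \<in> \<Delta>"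
      using EA_instances[OF Succ_inject, of "case_nat (num m) (\<lambda>_. num k)"] by (simp split: nat.splits)
    then show ?thesis using Suc.prems Suc.IH Suc mp by auto
  qed
qed

definition elem :: "trm \<Rightarrow> nat" where
  "elem t = to_nat_on (eq_class ` Collect wf_trm) (eq_class t)"

lemma elem_bij: "bij_betw (to_nat_on (eq_class ` Collect wf_trm)) (eq_class ` Collect wf_trm) UNIV"
proof (rule to_nat_on_infinite)
  show "countable (eq_class ` Collect wf_trm)" by simp
  have "inj (\<lambda>n. eq_class (num n))"
    by (rule injI) (simp add: eq_class_eq_iff num_inject)
  then have "infinite (range (\<lambda>n. eq_class (num n)))" by (rule range_inj_infinite)
  moreover have "range (\<lambda>n. eq_class (num n)) \<subseteq> eq_class ` Collect wf_trm" by auto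
  ultimately show "infinite (eq_class ` Collect wf_trm)" using finite_subset by blast
qed

lemma elem_eq_iff: "wf_trm s \<Longrightarrow> wf_trm t \<Longrightarrow> elem s = elem t \<longleftrightarrow> Eq s t \<in> \<Delta>"
  unfolding elem_def eq_class_eq_iff[symmetric]
  using bij_betw_imp_inj_on[OF elem_bij] by (auto dest: inj_onD)

lemma elem_surj: "\<exists>t. wf_trm t \<and> elem t = d"
proof -
  have "d \<in> to_nat_on (eq_class ` Collect wf_trm) ` eq_class ` Collect wf_trm"
    unfolding bij_betw_imp_surj_on[OF elem_bij] by simp
  then show ?thesis by (auto simp: elem_def)
qed

definition repr :: "nat \<Rightarrow> trm" where
  "repr d = (SOME t. wf_trm t \<and> elem t = d)"

lemma repr: "wf_trm (repr d)" "elem (repr d) = d"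
  using someI_ex[OF elem_surj[of d]] by (auto simp: repr_def)

lemma Eq_repr_elem: "wf_trm t \<Longrightarrow> Eq (repr (elem t)) t \<in> \<Delta>"
  using repr elem_eq_iff by metis

definition term_model :: "nat model" where
  "term_model = \<lparr> Fun = (\<lambda>f ds. elem (Fn f (map repr ds))),
     Lt = (\<lambda>x y. Less (repr x) (repr y) \<in> \<Delta>),
     Sets = range (\<lambda>i. {d. SVar i (repr d) \<in> \<Delta>}),
     Rel = (\<lambda>_. {}) \<rparr>"

definition set_of :: "nat \<Rightarrow> nat set" where
  "set_of i = {d. SVar i (repr d) \<in> \<Delta>}"

lemma term_model_simps [simp]:
  "Sets term_model = range set_of"
  "Fun term_model f ds = elem (Fn f (map repr ds))"
  "Lt term_model x y \<longleftrightarrow> Less (repr x) (repr y) \<in> \<Delta>"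
  by (auto simp: term_model_def set_of_def)

lemma eval_term_model:
  "wf_trm t \<Longrightarrow> (\<And>i. wf_trm (s i)) \<Longrightarrow> eval term_model (\<lambda>i. elem (s i)) t = elem (sub_trm s t)"
proof (induction t)
  case (Fn f ts)
  have *: "map (eval term_model (\<lambda>i. elem (s i))) ts = map (\<lambda>t. elem (sub_trm s t)) ts"
    using Fn by auto
  have "Eq (Fn f (map (\<lambda>t. repr (elem (sub_trm s t))) ts)) (Fn f (map (sub_trm s) ts)) \<in> \<Delta>"
    using Fn.prems
    by (intro Eq_Fn) (auto simp: list_all2_conv_all_nth wf_sub_trm intro!: Eq_repr_elem)
  then show ?case
    unfolding eval.simps * using Fn.prems
    by (subst term_model_simps) (auto simp: comp_def elem_eq_iff repr wf_sub_trm)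
qed simp

lemma mem_set_of: "wf_trm t \<Longrightarrow> elem t \<in> set_of i \<longleftrightarrow> SVar i t \<in> \<Delta>"
proof -
  assume t: "wf_trm t"
  have "SVar i u \<in> \<Delta>" if "Eq s u \<in> \<Delta>" "SVar i s \<in> \<Delta>" for s u
    using Leibniz[OF that(1), of "SVar i (Var 0)"] that(2) by (simp add: inst_simps)
  with Eq_repr_elem[OF t] Eq_sym show ?thesis unfolding set_of_def by blast
qed

lemma Less_elem: "wf_trm t \<Longrightarrow> wf_trm u \<Longrightarrow> Lt term_model (elem t) (elem u) \<longleftrightarrow> Less t u \<in> \<Delta>"
proof -
  assume wf: "wf_trm t" "wf_trm u"
  have *: "Less t' u' \<in> \<Delta>"
    if E: "Eq t t' \<in> \<Delta>" "Eq u u' \<in> \<Delta>" and L: "Less t u \<in> \<Delta>" for t u t' u'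
  proof -
    have wf: "wf_trm t" "wf_trm u" "wf_trm t'" "wf_trm u'" using E language by fastforce+
    have "Less t' u \<in> \<Delta>"
      using Leibniz[OF E(1), of "Less (Var 0) (lift_trm u)"] L wf
      by (simp add: inst_simps sub_trm_lift)
    then show ?thesis
      using Leibniz[OF E(2), of "Less (lift_trm t') (Var 0)"] wf
      by (simp add: inst_simps sub_trm_lift)
  qed
  show ?thesis
    using *[OF Eq_repr_elem[OF wf(1)] Eq_repr_elem[OF wf(2)]]
      *[OF Eq_sym[OF Eq_repr_elem[OF wf(1)]] Eq_sym[OF Eq_repr_elem[OF wf(2)]]]
    by auto
qed

lemma case_nat_elem: "case_nat (elem t) (\<lambda>i. elem (s i)) = (\<lambda>i. elem (case_nat t s i))"
  by (auto split: nat.splits)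

lemma case_nat_set_of: "case_nat (set_of j) (\<lambda>i. set_of (r i)) = (\<lambda>i. set_of (case_nat j r i))"
  by (auto split: nat.splits)

lemma all_elem: "(\<forall>d. P d) \<longleftrightarrow> (\<forall>t. wf_trm t \<longrightarrow> P (elem t))"
  using repr by metis

lemma ex_elem: "(\<exists>d. P d) \<longleftrightarrow> (\<exists>t. wf_trm t \<and> P (elem t))"
  using repr by metis

text \<open>
  Assignments are given by terms and set variables, so that the induction passes through the quantifiers: an
  element of the universe is the value of a term, and a set of the model is named by a set variable.
\<close>

lemma truth:
  "A \<in> lang2 \<Longrightarrow> (\<And>i. wf_trm (s i)) \<Longrightarrow>
    sat term_model (\<lambda>i. elem (s i)) (\<lambda>i. set_of (r i)) A \<longleftrightarrow> sub s (renS r A) \<in> \<Delta>"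
proof (induction A arbitrary: s r)
  case (Eq t u)
  then show ?case by (simp add: eval_term_model elem_eq_iff wf_sub_trm)
next
  case (Less t u)
  then show ?case
    by (simp add: eval_term_model Less_elem wf_sub_trm del: term_model_simps)
next
  case (SVar i t)
  then show ?case by (simp add: eval_term_model mem_set_of wf_sub_trm)
next
  case (RPred \<phi> t)
  then show ?case by simp
next
  case (Neg A)
  then show ?case by (simp add: complete lang2_sub)
next
  case (Conj A B)
  then show ?case by (simp add: Conj_mem lang2_sub)
next
  case (Disj A B)
  then show ?case by (simp add: Disj_mem lang2_sub)
next
  case (Forall A)
  have L: "sub (up s) (renS r A) \<in> lang2"
    using Forall.prems by (intro lang2_sub wf_up) simp_all
  have "sat term_model (\<lambda>i. elem (case_nat t s i)) (\<lambda>i. set_of (r i)) A \<longleftrightarrow>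
      sub (case_nat t s) (renS r A) \<in> \<Delta>" if "wf_trm t" for t
    by (rule Forall.IH) (use Forall.prems that in \<open>auto split: nat.splits\<close>)
  then show ?case
    by (simp add: all_elem[where P = "\<lambda>d. sat _ (case_nat d _) _ _"] case_nat_elem
        Forall_mem[OF L] inst_sub_up)
next
  case (Exists A)
  have L: "sub (up s) (renS r A) \<in> lang2"
    using Exists.prems by (intro lang2_sub wf_up) simp_all
  have "sat term_model (\<lambda>i. elem (case_nat t s i)) (\<lambda>i. set_of (r i)) A \<longleftrightarrow>
      sub (case_nat t s) (renS r A) \<in> \<Delta>" if "wf_trm t" for t
    by (rule Exists.IH) (use Exists.prems that in \<open>auto split: nat.splits\<close>)
  then show ?case
    by (auto simp: ex_elem[where P = "\<lambda>d. sat _ (case_nat d _) _ _"] case_nat_elem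
        Exists_mem[OF L] inst_sub_up)
next
  case (ForallS A)
  have L: "sub s (renS (upS r) A) \<in> lang2"
    using ForallS.prems by (intro lang2_sub) simp_all
  have "sat term_model (\<lambda>i. elem (s i)) (\<lambda>i. set_of (case_nat j r i)) A \<longleftrightarrow>
      sub s (renS (case_nat j r) A) \<in> \<Delta>" for j
    by (rule ForallS.IH) (use ForallS.prems in auto)
  then show ?case
    using ForallS_mem[OF L] by (simp add: case_nat_set_of instS_renS_upS flip: renS_sub)
next
  case (ExistsS A)
  have L: "sub s (renS (upS r) A) \<in> lang2"
    using ExistsS.prems by (intro lang2_sub) simp_all
  have "sat term_model (\<lambda>i. elem (s i)) (\<lambda>i. set_of (case_nat j r i)) A \<longleftrightarrow>
      sub s (renS (case_nat j r) A) \<in> \<Delta>" for j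
    by (rule ExistsS.IH) (use ExistsS.prems in auto)
  then show ?case
    using ExistsS_mem[OF L] by (simp add: case_nat_set_of instS_renS_upS flip: renS_sub)
qed

lemma valid_term_model:
  assumes "A \<in> T" and "A \<in> lang2"
  shows "valid term_model A"
  unfolding valid_def
proof (intro allI impI)
  fix e :: "nat \<Rightarrow> nat" and E :: "nat \<Rightarrow> nat set"
  assume "\<forall>i. E i \<in> Sets term_model"
  then have "\<forall>i. \<exists>j. E i = set_of j" by auto
  then obtain r where r: "E = (\<lambda>i. set_of (r i))" by metis
  have e: "e = (\<lambda>i. elem (repr (e i)))" by (simp add: repr)
  have "sub (\<lambda>i. repr (e i)) (renS r A) \<in> \<Delta>"
    using assms by (intro theorems prv_sub prv_renS Ax) (auto simp: repr)
  then show "sat term_model e E A"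
    unfolding r by (subst e, subst truth) (simp_all add: repr assms)
qed

end

text \<open>
  The axioms of \<open>EA\<close> exclude finite models, for which the universe \<open>nat\<close> would be too large.
\<close>

theorem completeness:
  assumes "EA \<subseteq> T" and "A \<in> lang2"
    and valid: "\<And>M :: nat model. (\<And>B. B \<in> T \<Longrightarrow> B \<in> lang2 \<Longrightarrow> valid M B) \<Longrightarrow> valid M A"
  shows "prv T A"
proof (rule ccontr)
  assume "\<not> prv T A"
  moreover have "prv T A" if "prv T (Neg (Neg A))"
    by (rule taut1[OF that]) (use assms(2) in auto)
  ultimately have "consistent T (Neg A)" using assms(2) by (auto simp: consistent_def)
  then obtain \<Delta> where "henkin_set T \<Delta>" and A: "Neg A \<in> \<Delta>" using Lindenbaum by blast
  then interpret henkin_EA T \<Delta>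
    using assms(1) by (simp add: henkin_EA_def henkin_EA_axioms_def)
  have "sat term_model (\<lambda>i. elem (Var i)) (\<lambda>i. set_of i) A"
    using valid[OF valid_term_model] by (auto simp: valid_def)
  then have "sub Var (renS (\<lambda>i. i) A) \<in> \<Delta>"
    by (subst (asm) truth) (use assms(2) in auto)
  then show False using A complete[OF assms(2)] by simp
qed

section \<open>The formula classes\<close>

lemmas hier_Suc = hier.intros(5) and hier_Neg = hier.intros(6)
  and hier_Conj = hier.intros(7) and hier_Disj = hier.intros(8)
  and hier_Forall = hier.intros(11) and hier_Exists = hier.intros(12)

lemma sub_ForallB: "sub s (ForallB t A) = ForallB (sub_trm s t) (sub (up s) A)"
  by (simp add: ForallB_def lift_sub_trm) (simp add: up_def)

lemma sub_ExistsB: "sub s (ExistsB t A) = ExistsB (sub_trm s t) (sub (up s) A)"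
  by (simp add: ExistsB_def lift_sub_trm) (simp add: up_def)

lemma hier_sub: "hier p k A \<Longrightarrow> hier p k (sub s A)"
  by (induction arbitrary: s rule: hier.induct)
    (auto simp: sub_ForallB sub_ExistsB intro: hier.intros)

lemma renS_ForallB: "renS r (ForallB t A) = ForallB t (renS r A)"
  by (simp add: ForallB_def)

lemma renS_ExistsB: "renS r (ExistsB t A) = ExistsB t (renS r A)"
  by (simp add: ExistsB_def)

lemma hier_renS: "hier p k A \<Longrightarrow> hier p k (renS r A)"
  by (induction arbitrary: r rule: hier.induct)
    (auto simp: renS_ForallB renS_ExistsB intro: hier.intros)

lemma hier_arithmetical: "hier p k A \<Longrightarrow> arithmetical A"
  by (induction rule: hier.induct) (auto simp: ForallB_def ExistsB_def)

lemma hier_Imp: "hier (\<not> p) k A \<Longrightarrow> hier p k B \<Longrightarrow> hier p k (Imp A B)"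
  by (auto intro: hier.intros)

lemma hier_lift1: "hier p k A \<Longrightarrow> hier p k (lift1 A)"
  by (simp add: lift1_def hier_sub)

lemma repl_ForallB: "repl i \<sigma> (ForallB t A) = ForallB t (repl i (lift1 \<sigma>) A)"
  by (simp add: ForallB_def)

lemma repl_ExistsB: "repl i \<sigma> (ExistsB t A) = ExistsB t (repl i (lift1 \<sigma>) A)"
  by (simp add: ExistsB_def)

lemma occurs_only_ForallB [simp]: "occurs_only p i (ForallB t A) \<longleftrightarrow> occurs_only p i A"
  by (simp add: ForallB_def)

lemma occurs_only_ExistsB [simp]: "occurs_only p i (ExistsB t A) \<longleftrightarrow> occurs_only p i A"
  by (simp add: ExistsB_def)

lemma hier_atom: "(\<And>q. hier q 0 A) \<Longrightarrow> hier q k A"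
  by (induction k arbitrary: q) (auto intro: hier.intros)

lemma hier_Eq: "hier q k (Eq s t)"
  by (rule hier_atom) (rule hier.intros)

lemma hier_SVar: "hier q k (SVar i t)"
  by (rule hier_atom) (rule hier.intros)

text \<open>
  The complexity of \<open>\<phi>(\<sigma>,x)\<close> for \<open>\<sigma>\<close> in \<open>\<Pi>\<^sup>0\<^sub>k\<close>.  For bounded \<open>\<phi>\<close> it is determined by the polarity \<open>r\<close> of the
  occurrences of \<open>X\<close>; for \<open>\<phi>\<close> in \<open>\<Pi>\<^sup>0\<^sub>1\<close> or \<open>\<Sigma>\<^sup>0\<^sub>1\<close> the polarity has to agree with the class, since otherwise the
  unbounded quantifiers of \<open>\<phi>\<close> and of \<open>\<sigma>\<close> would alternate.
\<close>

lemma hier_repl: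
  assumes "hier q n \<phi>" and k: "k = Suc k'"
  shows "(n = 0 \<longrightarrow> (\<forall>r. occurs_only r i \<phi> \<longrightarrow> hier True k \<sigma> \<longrightarrow> hier r k (repl i \<sigma> \<phi>))) \<and>
    (n = 1 \<longrightarrow> occurs_only q i \<phi> \<longrightarrow> hier True k \<sigma> \<longrightarrow> hier q k (repl i \<sigma> \<phi>))"
  using assms(1)
proof (induction arbitrary: \<sigma> rule: hier.induct)
  case (3 p j t)
  show ?case by (auto simp: inst_def intro: hier_sub hier_SVar)
qed (auto simp: repl_ForallB repl_ExistsB k hier_lift1 intro: hier.intros hier_atom)

section \<open>Induction and comprehension in a model\<close>

lemma sat_ForallSs_aux:
  "sat M e E ((ForallS ^^ m) A) \<longleftrightarrow>
    (\<forall>G. (\<forall>i<m. G i \<in> Sets M) \<longrightarrow> (\<forall>i. G (i + m) = E i) \<longrightarrow> sat M e G A)"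
proof (induction m arbitrary: E)
  case 0
  have "G = E" if "\<forall>i. G i = E i" for G using that by auto
  then show ?case by auto
next
  case (Suc m)
  have "(\<forall>X\<in>Sets M. \<forall>G. (\<forall>i<m. G i \<in> Sets M) \<longrightarrow> (\<forall>i. G (i + m) = case_nat X E i) \<longrightarrow> sat M e G A)
    \<longleftrightarrow> (\<forall>G. (\<forall>i<Suc m. G i \<in> Sets M) \<longrightarrow> (\<forall>i. G (i + Suc m) = E i) \<longrightarrow> sat M e G A)"
    (is "?L \<longleftrightarrow> ?R")
  proof
    assume L: ?L
    show ?R
    proof (intro allI impI)
      fix G assume G: "\<forall>i<Suc m. G i \<in> Sets M" "\<forall>i. G (i + Suc m) = E i"
      then have "\<forall>i. G (i + m) = case_nat (G m) E i" by (auto split: nat.splits)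
      with L[rule_format, of "G m" G] G(1) show "sat M e G A" by simp
    qed
  next
    assume R: ?R
    show ?L
    proof (intro ballI allI impI)
      fix X G
      assume X: "X \<in> Sets M" and G: "\<forall>i<m. G i \<in> Sets M"
        and GX: "\<forall>i. G (i + m) = case_nat X E i"
      have "G m = X" using GX[rule_format, of 0] by simp
      moreover have "G (i + Suc m) = E i" for i using GX[rule_format, of "Suc i"] by simp
      ultimately show "sat M e G A" using R X G by (auto simp: less_Suc_eq)
    qed
  qed
  then show ?case by (simp add: Suc.IH)
qed

text \<open>
  If no set parameters occur, the assignment outside the block of quantifiers is irrelevant, and the block is the same
  as a quantifier over all assignments.  This makes its length disappear from the comprehension schema.
\<close>

lemma sat_ForallSs:
  assumes "fsv A \<subseteq> {..<m}" and "\<And>i. E i \<in> Sets M"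
  shows "sat M e E ((ForallS ^^ m) A) \<longleftrightarrow> (\<forall>G. (\<forall>i. G i \<in> Sets M) \<longrightarrow> sat M e G A)"
  unfolding sat_ForallSs_aux
proof (intro iffI allI impI)
  fix G :: "nat \<Rightarrow> 'a set"
  assume H: "\<forall>G. (\<forall>i<m. G i \<in> Sets M) \<longrightarrow> (\<forall>i. G (i + m) = E i) \<longrightarrow> sat M e G A"
    and G: "\<forall>i. G i \<in> Sets M"
  have "sat M e (\<lambda>i. if i < m then G i else E (i - m)) A"
    using H G by simp
  then show "sat M e G A"
    by (subst sat_cong[where E' = "\<lambda>i. if i < m then G i else E (i - m)"]) (use assms in auto)
next
  fix G :: "nat \<Rightarrow> 'a set"
  assume H: "\<forall>G. (\<forall>i. G i \<in> Sets M) \<longrightarrow> sat M e G A"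
    and G: "\<forall>i<m. G i \<in> Sets M" "\<forall>i. G (i + m) = E i"
  have "G i \<in> Sets M" for i
    using G(1) G(2)[rule_format, of "i - m"] assms(2)[of "i - m"] by (cases "i < m") auto
  then show "sat M e G A" using H by simp
qed

definition progressive_from_0 :: "fm \<Rightarrow> fm" where
  "progressive_from_0 \<theta> =
     Conj (inst \<theta> tzero) (Forall (Imp \<theta> (sub (case_nat (tsucc (Var 0)) (\<lambda>i. Var (Suc i))) \<theta>)))"

lemma induction_ax_eq: "induction_ax \<theta> = Imp (progressive_from_0 \<theta>) (Forall \<theta>)"
  by (simp add: induction_ax_def progressive_from_0_def)

abbreviation zero_of :: "'d model \<Rightarrow> 'd" where "zero_of M \<equiv> Fun M Zero []"
abbreviation succ_of :: "'d model \<Rightarrow> 'd \<Rightarrow> 'd" where "succ_of M d \<equiv> Fun M Succ [d]"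
abbreviation plus_of :: "'d model \<Rightarrow> 'd \<Rightarrow> 'd \<Rightarrow> 'd" where "plus_of M d d' \<equiv> Fun M Plus [d, d']"

lemma sat_succ:
  "sat M (case_nat d e) E (sub (case_nat (tsucc (Var 0)) (\<lambda>i. Var (Suc i))) \<theta>) \<longleftrightarrow>
    sat M (case_nat (succ_of M d) e) E \<theta>"
proof -
  have "(\<lambda>i. eval M (case_nat d e) (case_nat (tsucc (Var 0)) (\<lambda>i. Var (Suc i)) i))
      = case_nat (succ_of M d) e"
    by (auto split: nat.splits)
  then show ?thesis by (simp add: sat_sub)
qed

lemma sat_progressive:
  "sat M e E (progressive_from_0 \<theta>) \<longleftrightarrow>
    sat M (case_nat (zero_of M) e) E \<theta> \<and>
    (\<forall>d. sat M (case_nat d e) E \<theta> \<longrightarrow> sat M (case_nat (succ_of M d) e) E \<theta>)"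
  by (simp add: progressive_from_0_def sat_inst sat_succ)

text \<open>
  \<open>\<theta>(0) \<and> \<forall>x(\<theta>(x) \<rightarrow> \<theta>(x+1)) \<rightarrow> \<theta>(a)\<close>, where \<open>a\<close> is number variable \<open>0\<close>.  For each assignment to the set
  variables, \<open>a\<close> ranges over an inductive set.
\<close>

definition induct_fm :: "fm \<Rightarrow> fm" where
  "induct_fm \<theta> = Imp (lift (progressive_from_0 \<theta>)) \<theta>"

text \<open>
  The premise \<open>\<forall>x(\<theta>(x) \<rightarrow> \<theta>(x+1))\<close> has both \<open>\<theta>\<close> and its negation in the scope of a universal quantifier, hence it is
  \<open>\<Pi>\<^sup>0\<^sub>k\<^sub>+\<^sub>1\<close> no matter whether \<open>\<theta>\<close> is \<open>\<Pi>\<^sup>0\<^sub>k\<close> or \<open>\<Sigma>\<^sup>0\<^sub>k\<close>.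
\<close>

lemma hier_induct_fm:
  assumes "hier q k \<theta>"
  shows "hier False (Suc k) (induct_fm \<theta>)"
proof -
  have up: "hier r (Suc k) \<theta>" "hier r (Suc k) (inst \<theta> tzero)" for r
    using assms by (auto simp: inst_def intro: hier.intros hier_sub)
  have step: "hier True (Suc k) (Imp \<theta> (sub s \<theta>))" for s
    using up(1)[of False] up(1)[of True] by (auto intro: hier_Imp hier_sub)
  have "hier True (Suc k) (progressive_from_0 \<theta>)"
    unfolding progressive_from_0_def by (intro hier.intros up step)
  then show ?thesis
    unfolding induct_fm_def lift_def by (intro hier_Imp hier_sub up) simp
qed

lemma induct_fm_lang2: "\<theta> \<in> lang2 \<Longrightarrow> induct_fm \<theta> \<in> lang2"
  by (auto simp: induct_fm_def progressive_from_0_def intro!: lang2_inst lang2_lift lang2_sub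
      split: nat.splits)

lemma induct_fm_arithmetical: "arithmetical \<theta> \<Longrightarrow> arithmetical (induct_fm \<theta>)"
  by (auto simp: induct_fm_def progressive_from_0_def lift_def inst_def)

lemma induct_fm_fsv: "fsv (induct_fm \<theta>) = fsv \<theta>"
  by (auto simp: induct_fm_def progressive_from_0_def lift_def inst_def)

text \<open>
  If \<open>Sets M\<close> is empty there are no assignments and every formula is valid, so this case can be left out.
\<close>

locale comprehension_model =
  fixes M :: "'d model" and m :: nat and \<Lambda> :: "fm \<Rightarrow> bool"
  assumes axioms: "A \<in> EA \<union> {IND} \<union> Pi11_CA m \<Lambda> \<Longrightarrow> A \<in> lang2 \<Longrightarrow> valid M A"
    and nonempty: "Sets M \<noteq> {}"
begin

definition some_sets :: "nat \<Rightarrow> 'd set" where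
  "some_sets = (\<lambda>_. SOME X. X \<in> Sets M)"

lemma some_sets: "some_sets i \<in> Sets M"
  unfolding some_sets_def using nonempty by (simp add: some_in_eq)

lemma sat_axiom: "A \<in> EA \<union> {IND} \<union> Pi11_CA m \<Lambda> \<Longrightarrow> A \<in> lang2 \<Longrightarrow> sat M e some_sets A"
  using axioms some_sets by (auto simp: valid_def)

lemma induct_set:
  assumes "X \<in> Sets M" and "zero_of M \<in> X" and "\<And>d. d \<in> X \<Longrightarrow> succ_of M d \<in> X"
  shows "d \<in> X"
proof -
  have "sat M (\<lambda>_. d) some_sets IND"
    by (rule sat_axiom) (auto simp: IND_def)
  then show ?thesis using assms by (auto simp: IND_def)
qed

lemma comprehension:
  assumes "A \<in> lang2" and "arithmetical A" and "fsv A \<subseteq> {..<m}" and "\<Lambda> A"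
  shows "{d. \<forall>G. (\<forall>i. G i \<in> Sets M) \<longrightarrow> sat M (case_nat d e) G A} \<in> Sets M"
proof -
  have lang: "(ForallS ^^ n) A \<in> lang2" for n using assms(1) by (induction n) auto
  have "sat M e some_sets (ExistsS (Forall (Iff (SVar 0 (Var 0)) ((ForallS ^^ m) A))))"
    by (rule sat_axiom) (use assms lang in \<open>auto simp: Pi11_CA_def\<close>)
  then obtain Y where Y: "Y \<in> Sets M"
    and mem: "\<And>d. d \<in> Y \<longleftrightarrow> sat M (case_nat d e) (case_nat Y some_sets) ((ForallS ^^ m) A)"
    by auto
  have "case_nat Y some_sets i \<in> Sets M" for i using Y some_sets by (auto split: nat.splits)
  then have "d \<in> Y \<longleftrightarrow> (\<forall>G. (\<forall>i. G i \<in> Sets M) \<longrightarrow> sat M (case_nat d e) G A)" for d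
    unfolding mem using assms(3) by (intro sat_ForallSs)
  then have "Y = {d. \<forall>G. (\<forall>i. G i \<in> Sets M) \<longrightarrow> sat M (case_nat d e) G A}" by auto
  with Y show ?thesis by simp
qed

text \<open>
  An intersection of inductive sets is inductive, and \<open>W\<close> below is one over all assignments to the set variables.
  Unlike the single inductive sets it is definable without set parameters.
\<close>

lemma induction_ax_sat:
  assumes "\<theta> \<in> lang2" and "arithmetical \<theta>" and "fsv \<theta> \<subseteq> {..<m}" and "\<Lambda> (induct_fm \<theta>)"
    and E: "\<forall>i. E i \<in> Sets M"
  shows "sat M e E (induction_ax \<theta>)"
proof -
  define W where "W = {d. \<forall>G. (\<forall>i. G i \<in> Sets M) \<longrightarrow> sat M (case_nat d e) G (induct_fm \<theta>)}"
  have W: "W \<in> Sets M"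
    unfolding W_def
    by (rule comprehension) (use assms in \<open>auto simp: induct_fm_lang2 induct_fm_arithmetical induct_fm_fsv\<close>)
  have mem: "d \<in> W \<longleftrightarrow> (\<forall>G. (\<forall>i. G i \<in> Sets M) \<longrightarrow>
      sat M e G (progressive_from_0 \<theta>) \<longrightarrow> sat M (case_nat d e) G \<theta>)" for d
    by (auto simp: W_def induct_fm_def sat_lift)
  have "d \<in> W" for d
    by (rule induct_set[OF W]) (auto simp: mem sat_progressive)
  then show ?thesis using E by (auto simp: mem induction_ax_eq)
qed

end

theorem Sigma_induction:
  assumes "B \<in> Sigma_IND m k"
  shows "EA2_CA_proves m (Sigma0 (k + 1)) B"
  unfolding EA2_CA_proves_def
proof (rule completeness)
  from assms obtain \<theta> where B: "B = induction_ax \<theta>" and \<theta>: "\<theta> \<in> lang2" "Sigma0 k \<theta>" "card (fsv \<theta>) \<le> m"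
    by (auto simp: Sigma_IND_def)
  show "B \<in> lang2"
    using \<theta> by (auto simp: B induction_ax_def intro!: lang2_inst lang2_sub split: nat.splits)
  fix M :: "nat model"
  assume ax: "\<And>B. B \<in> EA \<union> {IND} \<union> Pi11_CA m (Sigma0 (k + 1)) \<Longrightarrow> B \<in> lang2 \<Longrightarrow> valid M B"
  show "valid M B"
  proof (cases "Sets M = {}")
    case False
    then interpret comprehension_model M m "Sigma0 (k + 1)" using ax by unfold_locales auto
    \<comment> \<open>The set parameters of \<open>\<theta>\<close> are renamed so that they fill the block of set quantifiers.\<close>
    obtain r where r: "inj_on r (fsv \<theta>)" "r ` fsv \<theta> \<subseteq> {..<m}"
      using card_le_inj[of "fsv \<theta>" "{..<m}"] \<theta>(3) finite_fsv by auto
    define r' where "r' = inv_into (fsv \<theta>) r"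
    have r'_r: "r' (r i) = i" if "i \<in> fsv \<theta>" for i
      using r(1) that by (simp add: r'_def)
    let ?\<theta> = "renS r \<theta>"
    have hier: "Sigma0 k ?\<theta>" using \<theta>(2) by (rule hier_renS)
    show ?thesis unfolding valid_def
    proof (intro allI impI)
      fix e :: "nat \<Rightarrow> nat" and E :: "nat \<Rightarrow> nat set" assume E: "\<forall>i. E i \<in> Sets M"
      have "sat M e (\<lambda>i. E (r' i)) (induction_ax ?\<theta>)"
        by (rule induction_ax_sat)
          (use \<theta> r E hier hier_arithmetical hier_induct_fm[OF hier] in
            \<open>auto simp: fsv_renS_arithmetical\<close>)
      moreover have "sat M e' (\<lambda>i. E (r' i)) ?\<theta> \<longleftrightarrow> sat M e' E \<theta>" for e'
        unfolding sat_renS by (rule sat_cong) (auto simp: r'_r)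
      ultimately show "sat M e E B"
        by (simp add: B induction_ax_eq sat_progressive)
    qed
  qed (simp add: valid_def)
qed auto

section \<open>Coding several sets into one\<close>

text \<open>
  The code of the pair of a number \<open>n\<close> and an element \<open>d\<close>, namely \<open>2\<^sup>n(2d + 1)\<close>.  As \<open>n\<close> is a standard number, it
  can be written with addition alone, and it is injective because doubling is injective and its values are never
  successors of such values.
\<close>

fun tag :: "nat \<Rightarrow> trm \<Rightarrow> trm" where
  "tag 0 t = tsucc (tplus t t)"
| "tag (Suc n) t = tplus (tag n t) (tag n t)"

lemma wf_tag [simp]: "wf_trm t \<Longrightarrow> wf_trm (tag n t)"
  by (induction n) (auto simp: numeral_2_eq_2)

definition dbl :: "'d model \<Rightarrow> 'd \<Rightarrow> 'd" where
  "dbl M d = plus_of M d d"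

definition tag_of :: "'d model \<Rightarrow> nat \<Rightarrow> 'd \<Rightarrow> 'd" where
  "tag_of M n d = (dbl M ^^ n) (succ_of M (dbl M d))"

lemma eval_tag [simp]: "eval M e (tag n t) = tag_of M n (eval M e t)"
  by (induction n) (auto simp: tag_of_def dbl_def)

text \<open>
  Each \<open>R\<^sub>\<psi>(t)\<close> becomes \<open>X(\<langle>\<psi>,t\<rangle>)\<close>, where \<open>X\<close> is set variable \<open>0\<close> and \<open>\<psi>\<close> is represented by its number in the
  enumeration of all formulas.
\<close>

primrec as_slices :: "fm \<Rightarrow> fm" where
  "as_slices (Eq s t) = Eq s t"
| "as_slices (Less s t) = Less s t"
| "as_slices (SVar i t) = SVar i t"
| "as_slices (RPred \<psi> t) = SVar 0 (tag (to_nat \<psi>) t)"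
| "as_slices (Neg A) = Neg (as_slices A)"
| "as_slices (Conj A B) = Conj (as_slices A) (as_slices B)"
| "as_slices (Disj A B) = Disj (as_slices A) (as_slices B)"
| "as_slices (Forall A) = Forall (as_slices A)"
| "as_slices (Exists A) = Exists (as_slices A)"
| "as_slices (ForallS A) = ForallS (as_slices A)"
| "as_slices (ExistsS A) = ExistsS (as_slices A)"

lemma wf_as_slices: "wf_fm A \<Longrightarrow> wf_fm (as_slices A)"
  by (induction A) auto

lemma preds_as_slices [simp]: "preds (as_slices A) = {}"
  by (induction A) auto

lemma arithmetical_as_slices [simp]: "arithmetical (as_slices A) = arithmetical A"
  by (induction A) auto

lemma fsv_as_slices: "arithmetical A \<Longrightarrow> fsv (as_slices A) \<subseteq> insert 0 (fsv A)"
  by (induction A) auto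

lemma as_slices_bounded:
  "as_slices (ForallB t A) = ForallB t (as_slices A)" "as_slices (ExistsB t A) = ExistsB t (as_slices A)"
  by (simp_all add: ForallB_def ExistsB_def)

lemma hier_as_slices: "hier p k A \<Longrightarrow> hier p k (as_slices A)"
  by (induction rule: hier.induct) (auto simp: as_slices_bounded intro: hier.intros)

lemma sat_as_slices:
  assumes "arithmetical A"
    and "\<And>\<psi> d. \<psi> \<in> preds A \<Longrightarrow> tag_of M (to_nat \<psi>) d \<in> E 0 \<longleftrightarrow> d \<in> r \<psi>"
  shows "sat M e E (as_slices A) \<longleftrightarrow> sat (M\<lparr>Rel := r\<rparr>) e E A"
  using assms by (induction A arbitrary: e) auto

section \<open>The interpretation of the fixed points\<close>

definition closed_fm :: "fm \<Rightarrow> fm" where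
  "closed_fm \<psi> = Forall (Imp \<psi> (SVar 0 (Var 0)))"

text \<open>
  The matrix \<open>\<Or>\<^sub>\<psi> \<exists>d (z = \<langle>\<psi>,d\<rangle> \<and> (\<psi>(X) \<subseteq> X \<rightarrow> d \<in> X))\<close>, where \<open>z\<close> is number variable \<open>0\<close>.  Existential instead of
  universal quantification over \<open>d\<close> keeps it in \<open>\<Sigma>\<^sup>0\<^sub>2\<close>; the two agree on codes of pairs.
\<close>

definition tagged_fixpoints_fm :: "fm list \<Rightarrow> fm" where
  "tagged_fixpoints_fm \<psi>s = foldr (\<lambda>\<psi>. Disj
     (Exists (Conj (Eq (Var 1) (tag (to_nat \<psi>) (Var 0))) (Imp (closed_fm \<psi>) (SVar 0 (Var 0))))))
     \<psi>s (Neg (Eq tzero tzero))"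

text \<open>
  \<open>\<forall>x(\<phi>(\<sigma>,x) \<rightarrow> \<sigma>(x)) \<rightarrow> \<sigma>(u)\<close>, where \<open>u\<close> is number variable \<open>0\<close>.
\<close>

definition R2_fm :: "fm \<Rightarrow> fm \<Rightarrow> fm" where
  "R2_fm \<phi> \<sigma> = Imp (Forall (Imp (repl 0 (lift1 (lift1 \<sigma>)) \<phi>) (lift1 \<sigma>))) \<sigma>"

lemma wf_lift1: "wf_fm A \<Longrightarrow> wf_fm (lift1 A)"
  unfolding lift1_def by (rule wf_fm_sub) (auto split: nat.splits)

lemma lift1_simps [simp]:
  "preds (lift1 A) = preds A" "fsv (lift1 A) = fsv A" "arithmetical (lift1 A) = arithmetical A"
  by (simp_all add: lift1_def)

lemma lift1_lang2: "A \<in> lang2 \<Longrightarrow> lift1 A \<in> lang2"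
  by (auto simp: lang2_def wf_lift1)

lemma inst_parts [simp]:
  "preds (inst A t) = preds A" "fsv (inst A t) = fsv A" "arithmetical (inst A t) = arithmetical A"
  by (simp_all add: inst_def)

lemma repl_lang2:
  "A \<in> lang2 \<Longrightarrow> arithmetical A \<Longrightarrow> \<sigma> \<in> lang2 \<Longrightarrow> repl i \<sigma> A \<in> lang2"
  by (induction A arbitrary: \<sigma>) (auto simp: lang2_inst lift1_lang2)

lemma arithmetical_repl:
  "arithmetical A \<Longrightarrow> arithmetical \<sigma> \<Longrightarrow> arithmetical (repl i \<sigma> A)"
  by (induction A arbitrary: \<sigma>) auto

lemma fsv_repl: "arithmetical A \<Longrightarrow> fsv (repl i \<sigma> A) \<subseteq> fsv \<sigma> \<union> (fsv A - {i})"
proof (induction A arbitrary: \<sigma>)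
  case (Forall A)
  from Forall.IH[of "lift1 \<sigma>"] Forall.prems show ?case by auto
next
  case (Exists A)
  from Exists.IH[of "lift1 \<sigma>"] Exists.prems show ?case by auto
next
  case (Conj A B)
  from Conj.IH[of \<sigma>] Conj.prems show ?case by auto
next
  case (Disj A B)
  from Disj.IH[of \<sigma>] Disj.prems show ?case by auto
qed auto

lemma hier_R2_fm:
  assumes "hier True 1 \<phi>" and "occurs_only True 0 \<phi>" and "hier True k \<sigma>" and "k = Suc k'"
  shows "hier False (Suc k) (R2_fm \<phi> \<sigma>)"
proof -
  have "hier True k (repl 0 (lift1 (lift1 \<sigma>)) \<phi>)"
    using hier_repl[OF assms(1,4), of 0] assms by (simp add: hier_lift1)
  then have 1: "hier False (Suc k) (repl 0 (lift1 (lift1 \<sigma>)) \<phi>)" by (rule hier.intros)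
  have 2: "hier True (Suc k) (lift1 \<sigma>)" "hier False (Suc k) \<sigma>"
    using assms(3) by (auto intro: hier.intros hier_lift1)
  have "hier True (Suc k) (Forall (Imp (repl 0 (lift1 (lift1 \<sigma>)) \<phi>) (lift1 \<sigma>)))"
    using 1 2 by (intro hier_Forall hier_Imp) auto
  then show ?thesis unfolding R2_fm_def using 2 by (auto intro: hier_Imp)
qed

lemma hier_tagged_fixpoints_fm:
  assumes "\<And>\<psi>. \<psi> \<in> set \<psi>s \<Longrightarrow> hier True 1 \<psi>"
  shows "hier False 2 (tagged_fixpoints_fm \<psi>s)"
  using assms
proof (induction \<psi>s)
  case Nil
  show ?case by (simp add: tagged_fixpoints_fm_def hier_Neg hier_Eq)
next
  case (Cons \<psi> \<psi>s)
  have "hier False (Suc 1) \<psi>" using Cons.prems by (auto intro: hier.intros)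
  then have "hier True (Suc 1) (closed_fm \<psi>)"
    unfolding closed_fm_def by (intro hier_Forall hier_Imp hier_Eq hier_SVar) simp
  then have "hier False (Suc 1)
      (Exists (Conj (Eq (Var 1) (tag (to_nat \<psi>) (Var 0))) (Imp (closed_fm \<psi>) (SVar 0 (Var 0)))))"
    by (intro hier_Exists hier_Conj hier_Imp hier_Eq hier_SVar) simp
  with Cons show ?case by (simp add: tagged_fixpoints_fm_def numeral_2_eq_2 hier.intros)
qed

lemma XposD:
  assumes "\<phi> \<in> Xpos"
  shows "\<phi> \<in> lang2" "arithmetical \<phi>" "fsv \<phi> \<subseteq> {0}" "fv \<phi> \<subseteq> {0}" "occurs_only True 0 \<phi>"
  using assms by (auto simp: Xpos_def)

lemma R2_fm_properties:
  assumes "\<phi> \<in> Xpos" and "\<sigma> \<in> lang2" and "arithmetical \<sigma>" and "fsv \<sigma> \<subseteq> {0}"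
  shows "R2_fm \<phi> \<sigma> \<in> lang2" "arithmetical (R2_fm \<phi> \<sigma>)" "fsv (R2_fm \<phi> \<sigma>) \<subseteq> {0}"
  using XposD[OF assms(1)] assms fsv_repl[of \<phi> 0 "lift1 (lift1 \<sigma>)"]
  by (auto simp: R2_fm_def repl_lang2 lift1_lang2 arithmetical_repl)

lemma tagged_fixpoints_fm_properties:
  assumes "set \<psi>s \<subseteq> Xpos"
  shows "tagged_fixpoints_fm \<psi>s \<in> lang2 \<and> arithmetical (tagged_fixpoints_fm \<psi>s) \<and>
    fsv (tagged_fixpoints_fm \<psi>s) \<subseteq> {0}"
  using assms
proof (induction \<psi>s)
  case Nil
  show ?case by (simp add: tagged_fixpoints_fm_def)
next
  case (Cons \<psi> \<psi>s)
  with XposD[of \<psi>] show ?case by (simp add: tagged_fixpoints_fm_def closed_fm_def)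
qed

definition closed :: "'d model \<Rightarrow> fm \<Rightarrow> 'd set \<Rightarrow> bool" where
  "closed M \<psi> X \<longleftrightarrow> (\<forall>d. sat M (\<lambda>_. d) (\<lambda>_. X) \<psi> \<longrightarrow> d \<in> X)"

definition fixpoint :: "'d model \<Rightarrow> fm \<Rightarrow> 'd set" where
  "fixpoint M \<psi> = {d. \<forall>X\<in>Sets M. closed M \<psi> X \<longrightarrow> d \<in> X}"

lemma sat_Xpos:
  "\<psi> \<in> Xpos \<Longrightarrow> sat M e E \<psi> \<longleftrightarrow> sat M (\<lambda>_. e 0) (\<lambda>_. E 0) \<psi>"
  using XposD[of \<psi>] by (intro sat_cong) auto

lemma sat_closed_fm: "\<psi> \<in> Xpos \<Longrightarrow> sat M e E (closed_fm \<psi>) \<longleftrightarrow> closed M \<psi> (E 0)"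
  unfolding closed_fm_def closed_def by (simp add: sat_Xpos[of \<psi> M "case_nat _ e" E])

lemma sat_tagged_fixpoints_fm:
  "set \<psi>s \<subseteq> Xpos \<Longrightarrow> sat M (case_nat z e) E (tagged_fixpoints_fm \<psi>s) \<longleftrightarrow>
    (\<exists>\<psi>\<in>set \<psi>s. \<exists>d. z = tag_of M (to_nat \<psi>) d \<and> (closed M \<psi> (E 0) \<longrightarrow> d \<in> E 0))"
  by (induction \<psi>s) (auto simp: tagged_fixpoints_fm_def sat_closed_fm)

lemma sat_inI: "\<phi> \<in> Xpos \<Longrightarrow> sat M e E (inI \<phi> t) \<longleftrightarrow> eval M e t \<in> fixpoint M \<phi>"
  using sat_closed_fm[of \<phi> M e] by (simp add: inI_def fixpoint_def closed_fm_def[symmetric])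

lemma sat_replR:
  "\<phi> \<in> Xpos \<Longrightarrow> arithmetical A \<Longrightarrow> preds A \<subseteq> {\<phi>} \<Longrightarrow>
    sat M e E (replR \<phi> A) \<longleftrightarrow> sat (M\<lparr>Rel := fixpoint M\<rparr>) e E A"
  by (induction A arbitrary: e) (auto simp: sat_inI)

lemma replR_lang2:
  assumes "\<phi> \<in> Xpos"
  shows "wf_fm A \<Longrightarrow> preds A \<subseteq> {\<phi>} \<Longrightarrow> replR \<phi> A \<in> lang2"
proof -
  have "inI \<phi> t \<in> lang2" if "wf_trm t" for t
    using XposD(1)[OF assms] that by (simp add: inI_def)
  then show "wf_fm A \<Longrightarrow> preds A \<subseteq> {\<phi>} \<Longrightarrow> replR \<phi> A \<in> lang2"
    by (induction A) auto
qed

lemma preds_EA: "A \<in> EA \<Longrightarrow> preds A = {}"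
  by (induction rule: EA.induct) (auto simp: induction_ax_def inst_def lang1_def)

text \<open>
  The closure conditions on \<open>\<Lambda>\<close> list the instances of comprehension that are used.  With \<open>\<Lambda>\<close> the class \<open>\<Sigma>\<^sup>0\<^sub>k\<^sub>+\<^sub>1\<close>
  and \<open>K\<close> the class \<open>\<Pi>\<^sup>0\<^sub>k\<close> they hold for \<open>\<Pi>\<^sup>0\<^sub>1\<close> operators, and with \<open>\<Lambda>\<close>, \<open>K\<close> trivial they hold for all.
\<close>

locale fixpoint_model = comprehension_model M m \<Lambda>
  for M :: "'d model" and m :: nat and \<Lambda> :: "fm \<Rightarrow> bool" +
  fixes C :: "fm set" and K :: "fm \<Rightarrow> bool"
  assumes block: "m \<ge> 1"
    and C: "C \<subseteq> Xpos"
    and Sigma2: "Sigma0 2 A \<Longrightarrow> \<Lambda> A"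
    and tagged: "set \<psi>s \<subseteq> C \<Longrightarrow> \<Lambda> (tagged_fixpoints_fm \<psi>s)"
    and Ind: "K \<theta> \<Longrightarrow> \<Lambda> (induct_fm (as_slices \<theta>))"
    and R2: "\<phi> \<in> C \<Longrightarrow> K \<sigma> \<Longrightarrow> \<Lambda> (R2_fm \<phi> (as_slices \<sigma>))"
begin

text \<open>
  A formula without set variables defines a set by a vacuous instance of comprehension.  This goes beyond the bounded
  induction of \<open>EA\<close> and is used for a few facts about addition.
\<close>

lemma num_induct:
  assumes "A \<in> lang2" and "Sigma0 2 A" and "fsv A = {}"
    and "sat M (case_nat (zero_of M) e) some_sets A"
    and "\<And>d. sat M (case_nat d e) some_sets A \<Longrightarrow> sat M (case_nat (succ_of M d) e) some_sets A"
  shows "sat M (case_nat d e) some_sets A"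
proof -
  have W: "{d. \<forall>G. (\<forall>i. G i \<in> Sets M) \<longrightarrow> sat M (case_nat d e) G A} \<in> Sets M"
    using assms Sigma2 hier_arithmetical by (intro comprehension) auto
  have "sat M (case_nat d e) G A \<longleftrightarrow> sat M (case_nat d e) some_sets A" for d G
    by (rule sat_cong) (simp_all add: assms(3))
  then have "{d. \<forall>G. (\<forall>i. G i \<in> Sets M) \<longrightarrow> sat M (case_nat d e) G A}
      = {d. sat M (case_nat d e) some_sets A}"
    using some_sets by blast
  with W have "{d. sat M (case_nat d e) some_sets A} \<in> Sets M" by simp
  from induct_set[OF this, of d] assms(4,5) show ?thesis by simp
qed

lemma succ_neq_zero: "succ_of M d \<noteq> zero_of M"
  using sat_axiom[of "Neg (Eq (tsucc (Var 0)) tzero)" "\<lambda>_. d"] EA.Succ_neq_Zero by simp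

lemma succ_inject: "succ_of M d = succ_of M d' \<Longrightarrow> d = d'"
  using sat_axiom[of "Imp (Eq (tsucc (Var 0)) (tsucc (Var 1))) (Eq (Var 0) (Var 1))"
      "case_nat d (\<lambda>_. d')"] EA.Succ_inject by simp

lemma succ_eq_iff: "succ_of M d = succ_of M d' \<longleftrightarrow> d = d'"
  using succ_inject by auto

lemma plus_zero: "plus_of M d (zero_of M) = d"
  using sat_axiom[of "Eq (tplus (Var 0) tzero) (Var 0)" "\<lambda>_. d"] EA.Plus_Zero
  by (simp add: numeral_2_eq_2)

lemma plus_succ: "plus_of M d (succ_of M d') = succ_of M (plus_of M d d')"
  using sat_axiom[of "Eq (tplus (Var 0) (tsucc (Var 1))) (tsucc (tplus (Var 0) (Var 1)))"
      "case_nat d (\<lambda>_. d')"] EA.Plus_Succ by (simp add: numeral_2_eq_2)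

lemma succ_plus: "plus_of M (succ_of M d) d' = succ_of M (plus_of M d d')"
proof -
  let ?A = "Eq (tplus (tsucc (Var 1)) (Var 0)) (tsucc (tplus (Var 1) (Var 0)))"
  have "sat M (case_nat d' (\<lambda>_. d)) some_sets ?A"
    by (rule num_induct) (auto simp: plus_zero plus_succ numeral_2_eq_2 hier_Eq)
  then show ?thesis by simp
qed

lemma zero_or_succ: "d = zero_of M \<or> (\<exists>d'. d = succ_of M d')"
proof -
  let ?A = "Disj (Eq (Var 0) tzero) (Exists (Eq (Var 1) (tsucc (Var 0))))"
  have "sat M (case_nat d (\<lambda>_. d)) some_sets ?A"
    by (rule num_induct) (auto simp: numeral_2_eq_2 intro: hier.intros hier_Eq)
  then show ?thesis by simp
qed

lemma dbl_zero: "dbl M (zero_of M) = zero_of M"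
  by (simp add: dbl_def plus_zero)

lemma dbl_succ: "dbl M (succ_of M d) = succ_of M (succ_of M (dbl M d))"
  by (simp add: dbl_def plus_succ succ_plus)

lemma dbl_inject: "dbl M d = dbl M d' \<Longrightarrow> d = d'"
proof -
  let ?A = "Forall (Imp (Eq (tplus (Var 1) (Var 1)) (tplus (Var 0) (Var 0))) (Eq (Var 1) (Var 0)))"
  have sat: "sat M (case_nat x e) some_sets ?A \<longleftrightarrow> (\<forall>y. dbl M x = dbl M y \<longrightarrow> x = y)" for x e
    by (simp add: dbl_def)
  have "sat M (case_nat d (\<lambda>_. d)) some_sets ?A"
  proof (rule num_induct)
    have "hier True (Suc 0) ?A" by (intro hier_Forall hier_Neg hier_Imp hier_Eq)
    then show "Sigma0 2 ?A" unfolding numeral_2_eq_2 by (rule hier.intros)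
    show "sat M (case_nat (zero_of M) (\<lambda>_. d)) some_sets ?A"
      unfolding sat
    proof (intro allI impI)
      show "zero_of M = y" if "dbl M (zero_of M) = dbl M y" for y
        using that zero_or_succ[of y]
        by (auto simp: dbl_zero dbl_succ succ_neq_zero succ_neq_zero[symmetric])
    qed
    show "sat M (case_nat (succ_of M x) (\<lambda>_. d)) some_sets ?A"
      if "sat M (case_nat x (\<lambda>_. d)) some_sets ?A" for x
      unfolding sat
    proof (intro allI impI)
      show "succ_of M x = y" if "dbl M (succ_of M x) = dbl M y" for y
        using that zero_or_succ[of y] \<open>sat M (case_nat x (\<lambda>_. d)) some_sets ?A\<close>
        unfolding sat
        by (auto simp: dbl_zero dbl_succ succ_neq_zero succ_neq_zero[symmetric] succ_eq_iff)
    qed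
  qed (auto simp: numeral_2_eq_2)
  then show "dbl M d = dbl M d' \<Longrightarrow> d = d'" unfolding sat by blast
qed

lemma dbl_neq_succ_dbl: "dbl M d \<noteq> succ_of M (dbl M d')"
proof -
  let ?A = "Forall (Neg (Eq (tplus (Var 1) (Var 1)) (tsucc (tplus (Var 0) (Var 0)))))"
  have sat: "sat M (case_nat x e) some_sets ?A \<longleftrightarrow> (\<forall>y. dbl M x \<noteq> succ_of M (dbl M y))" for x e
    by (simp add: dbl_def)
  have "sat M (case_nat d (\<lambda>_. d)) some_sets ?A"
  proof (rule num_induct)
    have "hier True (Suc 0) ?A" by (intro hier_Forall hier_Neg hier_Imp hier_Eq)
    then show "Sigma0 2 ?A" unfolding numeral_2_eq_2 by (rule hier.intros)
    show "sat M (case_nat (zero_of M) (\<lambda>_. d)) some_sets ?A"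
      unfolding sat using succ_neq_zero by (metis dbl_zero)
    show "sat M (case_nat (succ_of M x) (\<lambda>_. d)) some_sets ?A"
      if "sat M (case_nat x (\<lambda>_. d)) some_sets ?A" for x
      unfolding sat
    proof (intro allI notI)
      show False if "dbl M (succ_of M x) = succ_of M (dbl M y)" for y
        using that zero_or_succ[of y] \<open>sat M (case_nat x (\<lambda>_. d)) some_sets ?A\<close>
        unfolding sat
        by (auto simp: dbl_zero dbl_succ succ_neq_zero succ_neq_zero[symmetric] succ_eq_iff)
    qed
  qed (auto simp: numeral_2_eq_2)
  then show ?thesis unfolding sat by blast
qed

lemma tag_of_inject: "tag_of M i d = tag_of M j d' \<Longrightarrow> i = j \<and> d = d'"
proof (induction i arbitrary: j)
  case 0
  then show ?case
    using dbl_neq_succ_dbl[symmetric]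
    by (cases j) (auto simp: tag_of_def succ_eq_iff dest: dbl_inject)
next
  case (Suc i)
  show ?case
  proof (cases j)
    case 0
    with Suc.prems dbl_neq_succ_dbl show ?thesis by (auto simp: tag_of_def)
  next
    case (Suc j')
    with Suc.prems have "tag_of M i d = tag_of M j' d'" by (auto simp: tag_of_def dest: dbl_inject)
    with Suc.IH Suc show ?thesis by simp
  qed
qed

text \<open>
  The matrix of the definition of \<open>Y\<close> at \<open>z = \<langle>\<psi>,d\<rangle>\<close> reduces to \<open>\<psi>(X) \<subseteq> X \<rightarrow> d \<in> X\<close>, because the code determines
  \<open>\<psi>\<close> and \<open>d\<close>.
\<close>

lemma fixpoints_coded:
  assumes "finite F" and "F \<subseteq> C"
  shows "\<exists>Y\<in>Sets M. \<forall>\<psi>\<in>F. \<forall>d. tag_of M (to_nat \<psi>) d \<in> Y \<longleftrightarrow> d \<in> fixpoint M \<psi>"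
proof -
  obtain \<psi>s where \<psi>s: "set \<psi>s = F" using finite_list[OF assms(1)] by blast
  have X: "set \<psi>s \<subseteq> Xpos" using \<psi>s assms C by auto
  have "{z. \<forall>G. (\<forall>i. G i \<in> Sets M) \<longrightarrow>
      sat M (case_nat z (\<lambda>_. zero_of M)) G (tagged_fixpoints_fm \<psi>s)} \<in> Sets M" (is "?Y \<in> _")
    using tagged_fixpoints_fm_properties[OF X] block tagged \<psi>s assms(2)
    by (intro comprehension) auto
  moreover have "tag_of M (to_nat \<psi>) d \<in> ?Y \<longleftrightarrow> d \<in> fixpoint M \<psi>" if \<psi>: "\<psi> \<in> F" for \<psi> d
  proof -
    have eq: "tag_of M (to_nat \<psi>) d = tag_of M (to_nat \<psi>') d' \<longleftrightarrow> \<psi>' = \<psi> \<and> d' = d" for \<psi>' d'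
      using tag_of_inject by fastforce
    have "tag_of M (to_nat \<psi>) d \<in> ?Y \<longleftrightarrow>
        (\<forall>G :: nat \<Rightarrow> 'd set. (\<forall>i. G i \<in> Sets M) \<longrightarrow> closed M \<psi> (G 0) \<longrightarrow> d \<in> G 0)"
      using \<psi> \<psi>s by (auto simp: sat_tagged_fixpoints_fm[OF X] eq)
    also have "\<dots> \<longleftrightarrow> d \<in> fixpoint M \<psi>"
    proof
      assume H: "\<forall>G :: nat \<Rightarrow> 'd set.
        (\<forall>i. G i \<in> Sets M) \<longrightarrow> closed M \<psi> (G 0) \<longrightarrow> d \<in> G 0"
      have "d \<in> X" if "X \<in> Sets M" "closed M \<psi> X" for X
        using H[rule_format, of "\<lambda>_. X"] that by simp
      then show "d \<in> fixpoint M \<psi>" by (simp add: fixpoint_def)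
    qed (auto simp: fixpoint_def)
    finally show ?thesis .
  qed
  ultimately show ?thesis by (intro bexI[where x = ?Y] ballI allI) simp_all
qed

abbreviation "N \<equiv> M\<lparr>Rel := fixpoint M\<rparr>"

lemma as_slices_coded:
  assumes "\<theta> \<in> lang1 C"
  shows "\<exists>Y\<in>Sets M. \<forall>e E. sat M e (\<lambda>_. Y) (as_slices \<theta>) \<longleftrightarrow> sat N e E \<theta>"
proof -
  have fin: "finite (preds \<theta>)" by (induction \<theta>) auto
  obtain Y where Y: "Y \<in> Sets M"
      "\<And>\<psi> d. \<psi> \<in> preds \<theta> \<Longrightarrow> tag_of M (to_nat \<psi>) d \<in> Y \<longleftrightarrow> d \<in> fixpoint M \<psi>"
    using fixpoints_coded[OF fin] assms by (auto simp: lang1_def)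
  have "sat M e (\<lambda>_. Y) (as_slices \<theta>) \<longleftrightarrow> sat N e (\<lambda>_. Y) \<theta>" for e
    using assms Y by (intro sat_as_slices) (auto simp: lang1_def)
  moreover have "sat N e (\<lambda>_. Y) \<theta> \<longleftrightarrow> sat N e E \<theta>" for e E
    using assms by (intro sat_cong) (auto simp: lang1_def)
  ultimately show ?thesis using Y(1) by blast
qed

lemma as_slices_properties:
  assumes "\<theta> \<in> lang1 C"
  shows "as_slices \<theta> \<in> lang2" "arithmetical (as_slices \<theta>)" "fsv (as_slices \<theta>) \<subseteq> {0}"
  using assms fsv_as_slices[of \<theta>] by (auto simp: lang1_def lang2_def wf_as_slices)

lemma valid_Ind:
  assumes \<theta>: "\<theta> \<in> lang1 C" and "K \<theta>"
  shows "valid N (induction_ax \<theta>)"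
  unfolding valid_def
proof (intro allI impI)
  fix e :: "nat \<Rightarrow> 'd" and E :: "nat \<Rightarrow> 'd set"
  obtain Y where Y: "Y \<in> Sets M" "\<And>e. sat M e (\<lambda>_. Y) (as_slices \<theta>) \<longleftrightarrow> sat N e E \<theta>"
    using as_slices_coded[OF \<theta>] by blast
  have "sat M e (\<lambda>_. Y) (induction_ax (as_slices \<theta>))"
    using as_slices_properties[OF \<theta>] Y(1) Ind[OF assms(2)] block
    by (intro induction_ax_sat) auto
  then show "sat N e E (induction_ax \<theta>)"
    by (simp add: induction_ax_eq sat_progressive Y(2))
qed

lemma fixpoint_least: "X \<in> Sets M \<Longrightarrow> closed M \<psi> X \<Longrightarrow> fixpoint M \<psi> \<subseteq> X"
  by (auto simp: fixpoint_def)

lemma Xpos_mono: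
  assumes "\<psi> \<in> Xpos" and "X \<subseteq> Y" and "sat M e (\<lambda>_. X) \<psi>"
  shows "sat M e (\<lambda>_. Y) \<psi>"
proof -
  have "sat M e ((\<lambda>_. X)(0 := Y)) \<psi>"
    using sat_mono[of \<psi> 0 "\<lambda>_. X" "(\<lambda>_. X)(0 := Y)" M e] XposD[OF assms(1)] assms by auto
  then show ?thesis
    by (subst (asm) sat_cong[where E' = "\<lambda>_. Y" and e' = e]) (use XposD[OF assms(1)] in auto)
qed

lemma sat_Xpos_repl:
  assumes "\<phi> \<in> Xpos"
  shows "sat M' e E (repl 0 \<sigma> \<phi>) \<longleftrightarrow>
    sat M' (\<lambda>_. e 0) (\<lambda>_. {d. sat M' (case_nat d e) E \<sigma>}) \<phi>"
  using XposD[OF assms] by (simp add: sat_repl sat_Xpos[OF assms, of M' e])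

lemma sat_N_Xpos: "\<phi> \<in> Xpos \<Longrightarrow> sat N e E \<phi> \<longleftrightarrow> sat M e E \<phi>"
  using XposD(1)[of \<phi>] by (intro sat_Rel_update) (simp add: lang2_def)

text \<open>
  If \<open>\<phi>(X) \<subseteq> X\<close> then \<open>I\<^sub>\<phi> \<subseteq> X\<close>, hence \<open>\<phi>(I\<^sub>\<phi>) \<subseteq> \<phi>(X) \<subseteq> X\<close> by positivity; so \<open>\<phi>(I\<^sub>\<phi>)\<close> is included in every such \<open>X\<close>.
\<close>

lemma valid_R1:
  assumes "\<phi> \<in> C"
  shows "valid N (R1_ax \<phi>)"
proof -
  have \<phi>: "\<phi> \<in> Xpos" using assms C by blast
  have "d \<in> fixpoint M \<phi>" if d: "sat M (\<lambda>_. d) (\<lambda>_. fixpoint M \<phi>) \<phi>" for d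
    unfolding fixpoint_def
  proof (intro CollectI ballI impI)
    fix X assume X: "X \<in> Sets M" "closed M \<phi> X"
    with Xpos_mono[OF \<phi> fixpoint_least d] show "d \<in> X" by (auto simp: closed_def)
  qed
  then show ?thesis
    by (simp add: valid_def R1_ax_def sat_Xpos_repl[OF \<phi>] sat_N_Xpos[OF \<phi>])
qed

lemma sat_R2_fm:
  assumes "\<phi> \<in> Xpos"
  shows "sat M (case_nat u e) G (R2_fm \<phi> \<sigma>) \<longleftrightarrow>
    (closed M \<phi> {d. sat M (case_nat d e) G \<sigma>} \<longrightarrow> sat M (case_nat u e) G \<sigma>)"
  by (auto simp: R2_fm_def sat_Xpos_repl[OF assms] sat_lift1 closed_def)

text \<open>
  The extension of \<open>\<sigma>\<close> need not be a set of the model, so \<open>I\<^sub>\<phi>\<close> cannot be compared with it directly.  The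
  intersection \<open>W\<close> of all extensions \<open>S G\<close> that are closed under \<open>\<phi>\<close>, as the set variable of the coded \<open>\<sigma>\<close> varies,
  is a set of the model and is closed under \<open>\<phi>\<close> as well, by positivity.
\<close>

lemma valid_R2:
  assumes "\<phi> \<in> C" and \<sigma>: "\<sigma> \<in> lang1 C" and "K \<sigma>"
  shows "valid N (R2_ax \<phi> \<sigma>)"
  unfolding valid_def
proof (intro allI impI)
  fix e :: "nat \<Rightarrow> 'd" and E :: "nat \<Rightarrow> 'd set"
  have \<phi>: "\<phi> \<in> Xpos" using assms C by blast
  obtain Y where Y: "Y \<in> Sets M" "\<And>e. sat M e (\<lambda>_. Y) (as_slices \<sigma>) \<longleftrightarrow> sat N e E \<sigma>"
    using as_slices_coded[OF \<sigma>] by blast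
  define S where "S G = {d. sat M (case_nat d e) G (as_slices \<sigma>)}" for G
  define W where "W = {u. \<forall>G. (\<forall>i. G i \<in> Sets M) \<longrightarrow> closed M \<phi> (S G) \<longrightarrow> u \<in> S G}"
  have "{u. \<forall>G. (\<forall>i. G i \<in> Sets M) \<longrightarrow> sat M (case_nat u e) G (R2_fm \<phi> (as_slices \<sigma>))} \<in> Sets M"
    by (rule comprehension)
      (use R2_fm_properties[OF \<phi> as_slices_properties[OF \<sigma>]] block R2[OF assms(1,3)] in auto)
  then have W: "W \<in> Sets M" by (simp add: W_def S_def sat_R2_fm[OF \<phi>])
  have "closed M \<phi> W" unfolding closed_def
  proof (intro allI impI)
    fix d assume d: "sat M (\<lambda>_. d) (\<lambda>_. W) \<phi>"
    show "d \<in> W" unfolding W_def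
    proof (intro CollectI allI impI)
      fix G assume G: "\<forall>i. G i \<in> Sets M" "closed M \<phi> (S G)"
      then have "W \<subseteq> S G" by (auto simp: W_def)
      from Xpos_mono[OF \<phi> this d] G(2) show "d \<in> S G" by (auto simp: closed_def)
    qed
  qed
  with W have sub: "fixpoint M \<phi> \<subseteq> W" by (rule fixpoint_least)
  have "u \<in> S (\<lambda>_. Y)" if "u \<in> fixpoint M \<phi>" "closed M \<phi> (S (\<lambda>_. Y))" for u
    using that sub Y(1) by (auto simp: W_def)
  then show "sat N e E (R2_ax \<phi> \<sigma>)"
    by (auto simp: R2_ax_def sat_Xpos_repl[OF \<phi>] sat_lift1 sat_N_Xpos[OF \<phi>] closed_def S_def Y(2))
qed

lemma valid_ID:
  assumes "A \<in> ID C K" and "A \<in> lang1 C"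
  shows "valid N A"
proof -
  have "valid N A" if "A \<in> EA"
  proof -
    have "A \<in> lang2" using preds_EA[OF that] assms(2) by (simp add: lang1_def lang2_def)
    with that axioms have "valid M A" by blast
    with preds_EA[OF that] show ?thesis by (simp add: valid_def sat_Rel_update)
  qed
  with assms show ?thesis using valid_Ind valid_R1 valid_R2 by (auto simp: ID_def)
qed

lemma valid_replR:
  assumes "provable (lang1 C) (ID C K) A" and "\<phi> \<in> Xpos" and "A \<in> lang1 {\<phi>}"
  shows "valid M (replR \<phi> A)"
  using soundness[OF assms(1) valid_ID] assms(2,3) by (simp add: valid_def sat_replR lang1_def)

end

theorem ID_interpretation:
  assumes "provable (lang1 C) (ID C K) A" and "\<phi> \<in> Xpos" and "A \<in> lang1 {\<phi>}"
    and "m \<ge> 1" and "C \<subseteq> Xpos" and "\<And>A. Sigma0 2 A \<Longrightarrow> \<Lambda> A"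
    and "\<And>\<psi>s. set \<psi>s \<subseteq> C \<Longrightarrow> \<Lambda> (tagged_fixpoints_fm \<psi>s)"
    and "\<And>\<theta>. K \<theta> \<Longrightarrow> \<Lambda> (induct_fm (as_slices \<theta>))"
    and "\<And>\<phi> \<sigma>. \<phi> \<in> C \<Longrightarrow> K \<sigma> \<Longrightarrow> \<Lambda> (R2_fm \<phi> (as_slices \<sigma>))"
  shows "EA2_CA_proves m \<Lambda> (replR \<phi> A)"
  unfolding EA2_CA_proves_def
proof (rule completeness)
  show "replR \<phi> A \<in> lang2" using assms(2,3) replR_lang2 by (simp add: lang1_def)
  fix M :: "nat model"
  assume ax: "\<And>B. B \<in> EA \<union> {IND} \<union> Pi11_CA m \<Lambda> \<Longrightarrow> B \<in> lang2 \<Longrightarrow> valid M B"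
  show "valid M (replR \<phi> A)"
  proof (cases "Sets M = {}")
    case False
    then interpret fixpoint_model M m \<Lambda> C K
      using ax assms by unfold_locales auto
    show ?thesis using valid_replR assms by blast
  qed (simp add: valid_def)
qed auto

theorem proposition1p2:
  fixes k :: nat
  assumes "k \<ge> 1"
  shows "(\<forall>m\<ge>1. \<forall>B\<in>Sigma_IND m k. EA2_CA_proves m (Sigma0 (k + 1)) B) \<and>
    (\<forall>\<phi> A. \<phi> \<in> Xpos \<longrightarrow> Pi0 1 \<phi> \<longrightarrow> A \<in> lang1 {\<phi>} \<longrightarrow> PiID_Pi1_proves k A \<longrightarrow>
       EA2_CA_proves 1 (Sigma0 (k + 1)) (replR \<phi> A)) \<and>
    (\<forall>\<phi> A. \<phi> \<in> Xpos \<longrightarrow> A \<in> lang1 {\<phi>} \<longrightarrow> ID1_proves A \<longrightarrow>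
       EA2_CA_proves 1 (\<lambda>_. True) (replR \<phi> A))"
proof (intro conjI allI impI ballI)
  fix m B assume "B \<in> Sigma_IND m k"
  then show "EA2_CA_proves m (Sigma0 (k + 1)) B" by (rule Sigma_induction)
next
  fix \<phi> A assume \<phi>: "\<phi> \<in> Xpos" "A \<in> lang1 {\<phi>}" and A: "PiID_Pi1_proves k A"
  obtain k' where k: "k = Suc k'" using assms by (cases k) auto
  have Sigma: "Sigma0 (k + 1) B" if B: "Sigma0 2 B" for B
  proof -
    have "Sigma0 (n + 2) B" for n using B by (induction n) (auto simp: numeral_2_eq_2 intro: hier.intros)
    from this[of k'] show ?thesis by (simp add: k)
  qed
  show "EA2_CA_proves 1 (Sigma0 (k + 1)) (replR \<phi> A)"
  proof (rule ID_interpretation[OF A[unfolded PiID_Pi1_proves_def] \<phi>])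
    show "Sigma0 (k + 1) (tagged_fixpoints_fm \<psi>s)" if "set \<psi>s \<subseteq> Xpos_Pi1" for \<psi>s
      using that by (intro Sigma hier_tagged_fixpoints_fm) (auto simp: Xpos_Pi1_def)
    show "Sigma0 (k + 1) (induct_fm (as_slices \<theta>))" if "Pi0 k \<theta>" for \<theta>
      using hier_induct_fm[OF hier_as_slices[OF that]] by simp
    show "Sigma0 (k + 1) (R2_fm \<psi> (as_slices \<sigma>))" if "\<psi> \<in> Xpos_Pi1" "Pi0 k \<sigma>" for \<psi> \<sigma>
      using hier_R2_fm[of \<psi> k "as_slices \<sigma>"] that k by (auto simp: Xpos_Pi1_def Xpos_def hier_as_slices)
  qed (use Sigma in \<open>auto simp: Xpos_Pi1_def\<close>)
next
  fix \<phi> A assume \<phi>: "\<phi> \<in> Xpos" "A \<in> lang1 {\<phi>}" and A: "ID1_proves A"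
  show "EA2_CA_proves 1 (\<lambda>_. True) (replR \<phi> A)"
    by (rule ID_interpretation[OF A[unfolded ID1_proves_def] \<phi>]) auto
qed

end
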